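(* Let $j\ge2$ be an integer and let $g_j:[-j,j]\to[-j,j]$ be the continuous map defined by $g_j(x)=x+1$ for $-j\le x\le-2$, $g_j(-1)=j$, $g_j(1)=-j$, $g_j(x)=x-1$ for $2\le x\le j$, and $g_j$ linear on each of the intervals $[-2,-1]$, $[-1,1]$, $[1,2]$. Define $\phi_j(n)=3^n-2$ for $1\le n\le j$; $\phi_j(n)=3^n-2-4n\cdot3^{n-j-1}$ for $j+1\le n\le 2j-1$; and $\phi_j(n)=\sum_{i=1}^j(2i-1)\phi_j(n-i)+\sum_{i=j+1}^{2j-1}(4j-2i-1)\phi_j(n-i)$ for $n\ge 2j$. Define $\psi_j(n)=3^n$ for $1\le n\le j-1$; $\psi_j(j)=3^j-2j$; $\psi_j(n)=3^n-4n\cdot3^{n-j-1}$ for $j+1\le n\le 2j-1$; and $\psi_j(n)=\sum_{i=1}^j(2i-1)\psi_j(n-i)+\sum_{i=j+1}^{2j-1}(4j-2i-1)\psi_j(n-i)$ for $n\ge 2j$. Then: (a) For every positive integer $n$, $\phi_j(n)$ is the number of distinct solutions of $g_j^n(x)=x$ in $[-j,j]$; consequently $\Phi_1(\phi_j,n)\equiv0\pmod n$ for all positive integers $n$. (b) For every positive integer $n$, $\psi_j(n)$ is the number of distinct solutions of $g_j^n(x)=-x$ in $[-j,j]$; consequently $\Phi_2(\psi_j,n)\equiv0\pmod{2n}$ for all positive integers $n$.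
   Context: $g_j^n$ denotes the $n$-th iterate of $g_j$. For an integer-valued function $\phi$ on the positive integers: $\Phi_1(\phi,n)=\sum_{d\mid n}\mu(d)\phi(n/d)$ ($\mu$ the Möbius function), equivalently $\Phi_1(\phi,1)=\phi(1)$ and for $n=p_1^{k_1}\cdots p_r^{k_r}$ (distinct primes) $\Phi_1(\phi,n)=\phi(n)-\sum_i\phi(n/p_i)+\sum_{i_1<i_2}\phi(n/(p_{i_1}p_{i_2}))-\cdots+(-1)^r\phi(n/(p_1\cdots p_r))$. Further, if $n=2^{k_0}p_1^{k_1}\cdots p_r^{k_r}$ with distinct odd primes $p_i$, $k_0\ge0$, $r\ge1$, $k_i\ge1$, then $\Phi_2(\phi,n)=\phi(n)-\sum_i\phi(n/p_i)+\sum_{i_1<i_2}\phi(n/(p_{i_1}p_{i_2}))-\cdots+(-1)^r\phi(n/(p_1\cdots p_r))$; if $n=2^k$ with $k\ge0$, then $\Phi_2(\phi,n)=\phi(n)-1$. *)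

theory Defs
  imports "HOL-Analysis.Analysis" "HOL-Number_Theory.Number_Theory"
    "HOL-Computational_Algebra.Squarefree"
begin

definition affine_interp :: "real \<Rightarrow> real \<Rightarrow> real \<Rightarrow> real \<Rightarrow> real \<Rightarrow> real" where
  "affine_interp a u b v x = u + (v - u) * (x - a) / (b - a)"

text \<open>
  Only the restriction of \<open>g_map j\<close> to the interval from \<open>- j\<close> to \<open>j\<close> is meaningful.
\<close>

definition g_map :: "nat \<Rightarrow> real \<Rightarrow> real" where
  "g_map j x =
     (if x \<le> -2 then x + 1
      else if x \<le> -1 then affine_interp (-2) (-1) (-1) (real j) x
      else if x \<le> 1 then affine_interp (-1) (real j) 1 (- real j) x
      else if x \<le> 2 then affine_interp 1 (- real j) 2 1 x
      else x - 1)"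

lemma g_map_left: "x \<le> -2 \<Longrightarrow> g_map j x = x + 1"
  by (simp add: g_map_def)

lemma g_map_right: "2 \<le> x \<Longrightarrow> g_map j x = x - 1"
  by (auto simp: g_map_def affine_interp_def)

lemma g_map_minus_one: "g_map j (-1) = real j"
  and g_map_one: "g_map j 1 = - real j"
  by (simp_all add: g_map_def affine_interp_def)

lemma g_map_affine:
  "-2 \<le> x \<Longrightarrow> x \<le> -1 \<Longrightarrow> g_map j x = affine_interp (-2) (-1) (-1) (real j) x"
  "-1 \<le> x \<Longrightarrow> x \<le> 1 \<Longrightarrow> g_map j x = affine_interp (-1) (real j) 1 (- real j) x"
  "1 \<le> x \<Longrightarrow> x \<le> 2 \<Longrightarrow> g_map j x = affine_interp 1 (- real j) 2 1 x"
  by (auto simp: g_map_def affine_interp_def)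

lemma continuous_on_g_map: "continuous_on UNIV (g_map j)"
proof -
  have aff: "continuous_on S (affine_interp a u b v)" for S a u b v
    unfolding affine_interp_def divide_inverse by (intro continuous_intros)
  have "continuous_on {..-2} (g_map j)"
    by (rule continuous_on_eq[where f = "\<lambda>x. x + 1"])
       (auto intro!: continuous_intros simp: g_map_left)
  moreover have "continuous_on {-2..-1} (g_map j)"
    by (rule continuous_on_eq[OF aff]) (auto simp: g_map_affine)
  moreover have "continuous_on {-1..1} (g_map j)"
    by (rule continuous_on_eq[OF aff]) (auto simp: g_map_affine)
  moreover have "continuous_on {1..2} (g_map j)"
    by (rule continuous_on_eq[OF aff]) (auto simp: g_map_affine)
  moreover have "continuous_on {2..} (g_map j)"
    by (rule continuous_on_eq[where f = "\<lambda>x. x - 1"])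
       (auto intro!: continuous_intros simp: g_map_right)
  ultimately have "continuous_on ({..-2} \<union> ({-2..-1} \<union> ({-1..1} \<union> ({1..2} \<union> {2..})))) (g_map j)"
    by (intro continuous_on_closed_Un closed_Un closed_atLeastAtMost closed_atMost closed_atLeast)
  moreover have "{..-2} \<union> ({-2..-1} \<union> ({-1..1} \<union> ({1..2} \<union> {2..}))) = (UNIV :: real set)"
    by auto
  ultimately show ?thesis by simp
qed

lemma g_map_self_map:
  assumes "j \<ge> 2" "x \<in> {- real j..real j}"
  shows "g_map j x \<in> {- real j..real j}"
proof -
  have j: "real j \<ge> 2" using assms by simp
  consider "x \<le> -2" | "-2 \<le> x" "x \<le> -1" | "-1 \<le> x" "x \<le> 1" | "1 \<le> x" "x \<le> 2" | "2 \<le> x"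
    by linarith
  then show ?thesis
  proof cases
    case 2
    then have "0 \<le> (real j + 1) * (x + 2)" "(real j + 1) * (x + 2) \<le> real j + 1"
      using j by (auto intro!: mult_left_le mult_nonneg_nonneg)
    moreover have "g_map j x = -1 + (real j + 1) * (x + 2)"
      using 2 by (simp add: g_map_affine affine_interp_def)
    ultimately show ?thesis using j unfolding atLeastAtMost_iff by (intro conjI) linarith+
  next
    case 3
    then have "real j * x \<le> real j * 1" "real j * (-1) \<le> real j * x"
      using j by (intro mult_left_mono; simp)+
    moreover have "g_map j x = - (real j * x)"
      using 3 by (simp add: g_map_affine affine_interp_def field_simps)
    ultimately show ?thesis by simp
  next
    case 4
    then have "0 \<le> (1 + real j) * (x - 1)" "(1 + real j) * (x - 1) \<le> 1 + real j"
      using j by (auto intro!: mult_left_le mult_nonneg_nonneg)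
    moreover have "g_map j x = - real j + (1 + real j) * (x - 1)"
      using 4 by (simp add: g_map_affine affine_interp_def)
    ultimately show ?thesis using j unfolding atLeastAtMost_iff by (intro conjI) linarith+
  qed (use assms j in \<open>auto simp: g_map_left g_map_right\<close>)
qed

text \<open>
  The sequences are indexed by the positive integers; their value at \<open>0\<close> is a dummy that is
  never used.
\<close>

function phi :: "nat \<Rightarrow> nat \<Rightarrow> int" where
  "phi j n =
     (if n = 0 then 0
      else if n \<le> j then 3 ^ n - 2
      else if n \<le> 2 * j - 1 then 3 ^ n - 2 - 4 * int n * 3 ^ (n - j - 1)
      else (\<Sum>i = 1..j. (2 * int i - 1) * phi j (n - i))
         + (\<Sum>i = j + 1..2 * j - 1. (4 * int j - 2 * int i - 1) * phi j (n - i)))"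
  by auto
termination by (relation "Wellfounded.measure snd") auto

function psi :: "nat \<Rightarrow> nat \<Rightarrow> int" where
  "psi j n =
     (if n = 0 then 0
      else if n \<le> j - 1 then 3 ^ n
      else if n = j then 3 ^ j - 2 * int j
      else if n \<le> 2 * j - 1 then 3 ^ n - 4 * int n * 3 ^ (n - j - 1)
      else (\<Sum>i = 1..j. (2 * int i - 1) * psi j (n - i))
         + (\<Sum>i = j + 1..2 * j - 1. (4 * int j - 2 * int i - 1) * psi j (n - i)))"
  by auto
termination by (relation "Wellfounded.measure snd") auto

declare phi.simps [simp del] psi.simps [simp del]

definition moebius :: "nat \<Rightarrow> int" where
  "moebius n = (if squarefree n then (-1) ^ card (prime_factors n) else 0)"

definition Phi1 :: "(nat \<Rightarrow> int) \<Rightarrow> nat \<Rightarrow> int" where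
  "Phi1 f n = (\<Sum>d | d dvd n. moebius d * f (n div d))"

text \<open>
  The alternating sum over \<open>i\<^sub>1 < \<dots> < i\<^sub>s\<close> is written as a sum over the sets \<open>S\<close> of odd prime
  divisors of \<open>n\<close>, the empty set giving the leading term \<open>f n\<close>.
\<close>

definition Phi2 :: "(nat \<Rightarrow> int) \<Rightarrow> nat \<Rightarrow> int" where
  "Phi2 f n =
     (if \<exists>k. n = 2 ^ k then f n - 1
      else (\<Sum>S \<in> Pow {p. prime p \<and> odd p \<and> p dvd n}. (-1) ^ card S * f (n div \<Prod>S)))"

end

theory Submission
  imports Defs
begin

text \<open>
  The integers \<open>\<plusminus>1, \<dots>, \<plusminus>j\<close> form one periodic orbit and cut the interval into \<open>2 j - 1\<close> Markov
  cells, so solutions of \<open>g^n x = \<plusminus> x\<close> correspond to walks of length \<open>n\<close> in the transition graph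
  from a cell to itself or to its mirror image: a walk is realised by a fixed-point argument
  and determines its point because \<open>g\<close> expands.

  The transition matrix commutes with the reflection \<open>v \<mapsto> - v\<close>. On the antisymmetric part it
  is a cyclic shift of order \<open>j\<close> with one eigenvalue \<open>1\<close> removed, with trace \<open>j [j | n] - 1\<close>; on the
  symmetric part the trace \<open>T\<close> satisfies \<open>T n = 2 T (n-1) + \<dots> + 2 T (n-j+1) + T (n-j)\<close>. The sum and
  the difference of the two traces are \<open>\<phi>\<close> and \<open>\<psi>\<close>.

  By inclusion--exclusion over primes, \<open>\<Phi>\<^sub>1\<close> counts the points of least period \<open>n\<close>, and \<open>\<Phi>\<^sub>2\<close>
  counts the nonzero solutions of \<open>g^n x = - x\<close> of least period \<open>2 n\<close>; both sets are unions of full orbits.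
\<close>

section \<open>Counting walks in the transition graph\<close>

definition cells :: "nat \<Rightarrow> int set" where
  "cells j = {- (int j - 1)..int j - 1}"

text \<open>The label \<open>v\<close> stands for [v, v+1] if \<open>v > 0\<close>, for [v-1, v] if
  \<open>v < 0\<close> and for [-1, 1] if \<open>v = 0\<close>; the successors are the cells that
  make up the image of cell \<open>v\<close>. The outer cells are translated towards 0, while [1, 2]
  is stretched over [-j, 1] and [-1, 1] over everything.\<close>

definition succs :: "nat \<Rightarrow> int \<Rightarrow> int set" where
  "succs j v =
     (if v \<ge> 2 then {v - 1}
      else if v = 1 then {- (int j - 1)..0}
      else if v = 0 then cells j
      else if v = -1 then {0..int j - 1}
      else {v + 1})"

fun walk_count :: "nat \<Rightarrow> nat \<Rightarrow> int \<Rightarrow> int \<Rightarrow> int" where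
  "walk_count j 0 u v = of_bool (u = v)"
| "walk_count j (Suc n) u v = (\<Sum>w\<in>succs j u. walk_count j n w v)"

lemma succs_uminus: "succs j (- v) = uminus ` succs j v"
  by (simp add: succs_def cells_def)

lemma walk_count_uminus: "walk_count j n (- u) (- v) = walk_count j n u v"
proof (induction n arbitrary: u)
  case (Suc n)
  then show ?case by (simp add: succs_uminus sum.reindex)
qed simp

lemma sum_cells:
  fixes f :: "int \<Rightarrow> 'a::comm_monoid_add"
  assumes "j \<ge> 1"
  shows "sum f (cells j) = f 0 + (\<Sum>k=1..<j. f (int k) + f (- int k))"
  using assms
proof (induction j rule: nat_induct_at_least)
  case (Suc j)
  have "cells (Suc j) = insert (int j) (insert (- int j) (cells j))"
    using Suc by (auto simp: cells_def)
  then have "sum f (cells (Suc j)) = f (int j) + (f (- int j) + sum f (cells j))"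
    using Suc by (auto simp: cells_def)
  then show ?case using Suc by (simp add: ac_simps)
qed (simp add: cells_def)

lemma sum_int_atLeast0: "(\<Sum>w\<in>{0..int j - 1}. f w) = (\<Sum>k<j. f (int k))"
  by (rule sum.reindex_bij_witness[of _ int nat]) auto

lemma sum_int_atMost0: "(\<Sum>w\<in>{- (int j - 1)..0}. f w) = (\<Sum>k<j. f (- int k))"
  by (rule sum.reindex_bij_witness[of _ "\<lambda>k. - int k" "\<lambda>w. nat (- w)"]) auto

text \<open>
  The symmetric and antisymmetric parts of the walk counts under the reflection \<open>u \<mapsto> - u\<close> of the
  starting cell evolve independently of each other.
\<close>

definition sym_count :: "nat \<Rightarrow> int \<Rightarrow> nat \<Rightarrow> nat \<Rightarrow> int" where
  "sym_count j v n u =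
     (if u = 0 then walk_count j n 0 v
      else walk_count j n (int u) v + walk_count j n (- int u) v)"

definition alt_count :: "nat \<Rightarrow> int \<Rightarrow> nat \<Rightarrow> nat \<Rightarrow> int" where
  "alt_count j v n u = walk_count j n (int u) v - walk_count j n (- int u) v"

text \<open>As the entry at \<open>0\<close> is not doubled, this is the number of walks of length
  \<open>n\<close> that end in \<open>v\<close>, from any starting cell.\<close>

definition sym_total :: "nat \<Rightarrow> int \<Rightarrow> nat \<Rightarrow> int" where
  "sym_total j v n = (\<Sum>u<j. sym_count j v n u)"

lemma sum_lessThan_eq_atLeast1:
  fixes f :: "nat \<Rightarrow> 'a::comm_monoid_add"
  assumes "j \<ge> 1"
  shows "(\<Sum>k<j. f k) = f 0 + (\<Sum>k=1..<j. f k)"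
  using assms sum.atLeast_Suc_lessThan[of 0 j f] by (simp add: atLeast0LessThan)

lemma sym_count_Suc_0:
  assumes "j \<ge> 1"
  shows "sym_count j v (Suc n) 0 = sym_total j v n"
  using assms
  by (simp add: sym_count_def sym_total_def succs_def sum_cells sum_lessThan_eq_atLeast1)

text \<open>The images of cells \<open>1\<close> and \<open>-1\<close> together cover every cell
  once and the middle cell once more.\<close>

lemma sym_count_Suc_1:
  assumes "j \<ge> 1"
  shows "sym_count j v (Suc n) 1 = sym_total j v n + sym_count j v n 0"
proof -
  have "sym_count j v (Suc n) 1
      = (\<Sum>k<j. walk_count j n (- int k) v) + (\<Sum>k<j. walk_count j n (int k) v)"
    unfolding sym_count_def by (simp add: succs_def sum_int_atLeast0 sum_int_atMost0[simplified])
  then show ?thesis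
    using assms by (simp add: sym_count_def sym_total_def sum_lessThan_eq_atLeast1 sum.distrib)
qed

lemma sym_count_Suc_ge2:
  assumes "u \<ge> 2"
  shows "sym_count j v (Suc n) u = sym_count j v n (u - 1)"
  using assms by (auto simp: sym_count_def succs_def of_nat_diff)

text \<open>Cells \<open>1\<close> and \<open>-1\<close> are mapped over the opposite halves, which
  flips the sign; their common successor \<open>0\<close> cancels.\<close>

lemma alt_count_Suc_1:
  assumes "j \<ge> 1"
  shows "alt_count j v (Suc n) 1 = - (\<Sum>u=1..<j. alt_count j v n u)"
proof -
  have "alt_count j v (Suc n) 1
      = (\<Sum>k<j. walk_count j n (- int k) v) - (\<Sum>k<j. walk_count j n (int k) v)"
    unfolding alt_count_def by (simp add: succs_def sum_int_atLeast0 sum_int_atMost0[simplified])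
  then show ?thesis
    using assms by (simp add: alt_count_def sum_lessThan_eq_atLeast1 sum_subtractf)
qed

lemma alt_count_Suc_ge2:
  assumes "u \<ge> 2"
  shows "alt_count j v (Suc n) u = alt_count j v n (u - 1)"
  using assms by (auto simp: alt_count_def succs_def of_nat_diff)

text \<open>
  The symmetric part of any state is read off a single scalar sequence \<open>E\<close> as
  \<open>E (n + j - u) + E (n + j - u - 1)\<close>; extending \<open>E\<close> backwards so that this also holds at time
  \<open>0\<close> makes the recurrence valid from the start.
\<close>

lemma sym_count_rec:
  assumes j: "j \<ge> 2" and u: "u < j"
  shows "sym_count j v (n + j) u = 2 * (\<Sum>i=1..<j. sym_count j v (n + i) u) + sym_count j v n u"
proof -
  let ?s = "sym_count j v"
  \<comment> \<open>\<open>F\<close> is forced by the initial state: \<open>F 0\<close> is its entry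
    at \<open>0\<close>, and two consecutive values of \<open>F\<close> must add up to the entry at
    the larger index. Its values fill the places of \<open>E\<close> that precede the
    totals.\<close>
  define F where "F = rec_nat (?s 0 0) (\<lambda>u r. ?s 0 (Suc u) - r)"
  define E where "E m = (if m < j then F (j - 1 - m) else sym_total j v (m - j))" for m
  have F: "F 0 = ?s 0 0" "F (Suc u) = ?s 0 (Suc u) - F u" for u
    by (simp_all add: F_def)
  have E0: "?s n 0 = E (n + j - 1)" for n
    using j by (cases n) (auto simp: E_def F sym_count_Suc_0)
  have E1: "?s n u = E (n + j - u) + E (n + j - u - 1)" if "1 \<le> u" "u < j" for n u
    using that
  proof (induction n arbitrary: u)
    case 0
    then obtain w where "u = Suc w" by (cases u) auto
    with 0 show ?case by (auto simp: E_def F)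
  next
    case (Suc n)
    show ?case
    proof (cases "u = 1")
      case True
      have "?s (Suc n) 1 = sym_total j v n + ?s n 0"
        using j by (intro sym_count_Suc_1) auto
      also have "\<dots> = E (n + j) + E (n + j - 1)" by (simp add: E0) (simp add: E_def)
      finally show ?thesis using True by simp
    next
      case False
      then have "?s (Suc n) u = ?s n (u - 1)"
        using Suc by (intro sym_count_Suc_ge2) auto
      then show ?thesis using Suc.IH[of "u - 1"] Suc.prems False by (simp add: Suc_diff_le)
    qed
  qed
  \<comment> \<open>Summing the entries at time \<open>m\<close> lists the values of
    \<open>E\<close> from \<open>m\<close> to \<open>m + j - 1\<close>, each twice except
    \<open>E m\<close>.\<close>
  have E_rec: "E (m + j) = 2 * (\<Sum>i=1..<j. E (m + i)) + E m" for m
  proof -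
    have "E (m + j) = ?s m 0 + (\<Sum>u=1..<j. ?s m u)"
      using j by (simp add: E_def sym_total_def sum_lessThan_eq_atLeast1)
    also have "\<dots> = E (m + j - 1) + (\<Sum>u=1..<j. E (m + j - u)) + (\<Sum>u=1..<j. E (m + j - u - 1))"
      by (simp add: E0 E1 sum.distrib)
    also have "(\<Sum>u=1..<j. E (m + j - u)) = (\<Sum>i=1..<j. E (m + i))"
      by (rule sum.reindex_bij_witness[of _ "\<lambda>i. j - i" "\<lambda>i. j - i"]) auto
    also have "(\<Sum>u=1..<j. E (m + j - u - 1)) = (\<Sum>i<j - 1. E (m + i))"
      by (rule sum.reindex_bij_witness[of _ "\<lambda>i. j - 1 - i" "\<lambda>i. j - 1 - i"]) auto
    also have "E (m + j - 1) + (\<Sum>i=1..<j. E (m + i)) + (\<Sum>i<j - 1. E (m + i))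
        = (\<Sum>i=1..<j. E (m + i)) + (\<Sum>i<j. E (m + i))"
      using j sum.lessThan_Suc[of "\<lambda>i. E (m + i)" "j - 1"] by (simp add: Suc_diff_Suc)
    also have "(\<Sum>i<j. E (m + i)) = E m + (\<Sum>i=1..<j. E (m + i))"
      using j by (simp add: sum_lessThan_eq_atLeast1)
    finally show ?thesis by simp
  qed
  \<comment> \<open>An entry is one value of \<open>E\<close> or the sum of two neighbouring ones,
    and both inherit the linear recurrence.\<close>
  show ?thesis
  proof (cases "u = 0")
    case True
    have "n + j + j - 1 = (n + j - 1) + j" "\<And>i. n + i + j - 1 = (n + j - 1) + i"
      using j by auto
    then show ?thesis using True E_rec[of "n + j - 1"] by (simp add: E0)
  next
    case False
    have eq: "n + j + j - u = (n + j - u) + j" "n + j - u + j - 1 = (n + j - u - 1) + j"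
      "\<And>i. n + i + j - u = (n + j - u) + i" "\<And>i. n + j - u + i - 1 = (n + j - u - 1) + i"
      using u by auto
    have "1 \<le> u" using False by simp
    note E1' = E1[OF this u]
    show ?thesis
      unfolding E1' eq E_rec sum.distrib by (simp add: algebra_simps)
  qed
qed

section \<open>Trace of the symmetric part: recurrence and initial values\<close>

definition sym_trace :: "nat \<Rightarrow> nat \<Rightarrow> int" where
  "sym_trace j n = (\<Sum>v<j. sym_count j (int v) n v)"

lemma sym_trace_rec:
  assumes "j \<ge> 2"
  shows "sym_trace j (n + j) = 2 * (\<Sum>i=1..<j. sym_trace j (n + i)) + sym_trace j n"
proof -
  have "sym_trace j (n + j)
      = (\<Sum>v<j. 2 * (\<Sum>i=1..<j. sym_count j (int v) (n + i) v) + sym_count j (int v) n v)"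
    unfolding sym_trace_def using assms by (intro sum.cong sym_count_rec) auto
  also have "\<dots> = 2 * (\<Sum>v<j. \<Sum>i=1..<j. sym_count j (int v) (n + i) v) + sym_trace j n"
    by (simp add: sum.distrib sum_distrib_left sym_trace_def)
  finally show ?thesis by (subst (asm) sum.swap) (simp add: sym_trace_def)
qed

lemma sym_count_0: "sym_count j (int v) 0 u = of_bool (u = v)"
  by (auto simp: sym_count_def)

lemma sym_trace_0: "sym_trace j 0 = int j"
  by (simp add: sym_trace_def sym_count_0)

text \<open>The new entry at \<open>0\<close> is the old total, the new entry at \<open>1\<close> is
  the old total plus the old entry at \<open>0\<close>, and the entries from \<open>1\<close> to
  \<open>j - 2\<close> move up. Only the entry at \<open>j - 1\<close> is lost.\<close>

lemma sym_total_Suc: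
  assumes "j \<ge> 2"
  shows "sym_total j v (Suc n) = 3 * sym_total j v n - sym_count j v n (j - 1)"
proof -
  obtain i where i: "j = Suc (Suc i)" by (rule that[of "j - 2"]) (use assms in simp)
  have "sym_total j v (Suc n)
      = sym_count j v (Suc n) 0 + (sym_count j v (Suc n) 1 + (\<Sum>u<i. sym_count j v (Suc n) (Suc (Suc u))))"
    unfolding sym_total_def i by (simp only: sum.lessThan_Suc_shift) simp
  also have "(\<Sum>u<i. sym_count j v (Suc n) (Suc (Suc u))) = (\<Sum>u<i. sym_count j v n (Suc u))"
    by (simp add: sym_count_Suc_ge2)
  finally have "sym_total j v (Suc n) = sym_count j v (Suc n) 0
      + (sym_count j v (Suc n) 1 + (\<Sum>u<i. sym_count j v n (Suc u)))" .
  moreover have "sym_count j v n 0 + (\<Sum>u<i. sym_count j v n (Suc u)) = (\<Sum>u<Suc i. sym_count j v n u)"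
    by (simp only: sum.lessThan_Suc_shift)
  moreover have "sym_total j v n = (\<Sum>u<Suc i. sym_count j v n u) + sym_count j v n (j - 1)"
    by (simp add: sym_total_def i)
  ultimately show ?thesis
    using assms sym_count_Suc_0[of j v n] sym_count_Suc_1[of j v n] by simp
qed

lemma sym_count_shift: "n < u \<Longrightarrow> sym_count j v n u = sym_count j v 0 (u - n)"
proof (induction n arbitrary: u)
  case (Suc n)
  then show ?case using Suc.IH[of "u - 1"] by (simp add: sym_count_Suc_ge2)
qed simp

text \<open>This entry appeared at position \<open>1\<close> at time \<open>n + 1\<close> and has
  only been shifted since.\<close>

lemma sym_count_diag:
  assumes "j \<ge> 1" "u \<ge> 1"
  shows "sym_count j v (n + u) u = sym_total j v n + sym_count j v n 0"
  using \<open>u \<ge> 1\<close>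
proof (induction u rule: nat_induct_at_least)
  case base
  then show ?case using sym_count_Suc_1[of j v n] assms by simp
next
  case (Suc u)
  then show ?case using sym_count_Suc_ge2[of "Suc u" j v "n + u"] by simp
qed

text \<open>As long as the last entry is zero, \<open>sym_total_Suc\<close> triples the total.
  Before each step of this range the last entry is still an initial entry, at a position larger than
  \<open>v\<close>.\<close>

lemma sym_total_eq_power:
  assumes "j \<ge> 2" "n + v \<le> j - 1"
  shows "sym_total j (int v) n = 3 ^ n"
  using assms(2)
proof (induction n)
  case 0
  have "v < j" using 0 assms by auto
  then show ?case by (simp add: sym_total_def sym_count_0)
next
  case (Suc n)
  have "sym_count j (int v) n (j - 1) = 0"
    using Suc.prems sym_count_shift[of n "j - 1" j "int v"] by (auto simp: sym_count_0)
  then show ?case using Suc sym_total_Suc[OF assms(1), of "int v" n] by simp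
qed

lemma sym_trace_small:
  assumes "j \<ge> 2" "1 \<le> n" "n < j"
  shows "sym_trace j n = 3 ^ n - 1"
proof -
  \<comment> \<open>By \<open>sym_count_diag\<close>, \<open>c m\<close> is the total plus the
    middle entry at time \<open>m = n - v\<close>. The middle entry is the preceding total
    \<open>3 ^ (m - 1)\<close>, except at time \<open>0\<close>, where it vanishes because
    \<open>v \<ge> 1\<close>.\<close>
  define c :: "nat \<Rightarrow> int" where "c m = (if m = 0 then 1 else 3 ^ m + 3 ^ (m - 1))" for m
  obtain k where k: "n = Suc k" using assms by (cases n) auto
  have diag: "sym_count j (int v) n v = c (n - v)" if "1 \<le> v" "v \<le> n" for v
  proof -
    define m where "m = n - v"
    then have m: "n = m + v" using that by simp
    have "sym_count j (int v) n v = sym_total j (int v) m + sym_count j (int v) m 0"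
      using sym_count_diag[of j v "int v" m] assms that m by simp
    moreover have "sym_total j (int v) m = 3 ^ m"
      using assms m by (intro sym_total_eq_power) auto
    moreover have "sym_count j (int v) m 0 = (if m = 0 then 0 else 3 ^ (m - 1))"
    proof (cases m)
      case 0
      then show ?thesis using that by (simp add: sym_count_0)
    next
      case (Suc l)
      have "sym_total j (int v) l = 3 ^ l"
        using assms m Suc by (intro sym_total_eq_power) auto
      then show ?thesis using Suc assms by (simp add: sym_count_Suc_0)
    qed
    ultimately show ?thesis using m by (auto simp: c_def)
  qed
  have zero: "sym_count j (int v) n v = 0" if "n < v" for v
    using sym_count_shift[OF that, of j "int v"] that assms by (auto simp: sym_count_0)
  have "sym_trace j n = sym_count j 0 n 0 + (\<Sum>v=1..<j. sym_count j (int v) n v)"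
    using assms by (simp add: sym_trace_def sum_lessThan_eq_atLeast1)
  also have "sym_count j 0 n 0 = 3 ^ k"
    using assms k sym_total_eq_power[of j k 0] by (simp add: sym_count_Suc_0)
  also have "(\<Sum>v=1..<j. sym_count j (int v) n v) = (\<Sum>v=1..n. c (n - v))"
    using assms by (intro sum.mono_neutral_cong_right) (auto simp: zero diag)
  also have "\<dots> = (\<Sum>m<n. c m)"
    by (rule sum.reindex_bij_witness[of _ "\<lambda>m. n - m" "\<lambda>m. n - m"]) auto
  also have "\<dots> = 2 * 3 ^ k - 1"
    unfolding k by (induction k) (auto simp: c_def)
  finally show ?thesis by (simp add: k)
qed

lemma sym_trace_rec':
  assumes "j \<ge> 2" "m \<ge> j"
  shows "sym_trace j m = 2 * (\<Sum>i=1..<j. sym_trace j (m - i)) + sym_trace j (m - j)"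
proof -
  define n where "n = m - j"
  then have n: "m = n + j" using assms by simp
  have "(\<Sum>i=1..<j. sym_trace j (m - i)) = (\<Sum>i=1..<j. sym_trace j (n + i))"
    by (rule sum.reindex_bij_witness[of _ "\<lambda>i. j - i" "\<lambda>i. j - i"]) (auto simp: n)
  then show ?thesis using sym_trace_rec[OF assms(1), of n] n by simp
qed

text \<open>The difference of two consecutive instances of \<open>sym_trace_rec\<close>, in which
  the long sums telescope.\<close>

lemma sym_trace_rec3:
  assumes "j \<ge> 2"
  shows "sym_trace j (Suc (n + j))
       = 3 * sym_trace j (n + j) - sym_trace j (Suc n) - sym_trace j n"
proof -
  let ?T = "sym_trace j"
  have "(\<Sum>i=1..<j. ?T (Suc n + i)) = (\<Sum>i=Suc 1..<Suc j. ?T (n + i))"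
    by (subst sum.shift_bounds_Suc_ivl) simp
  moreover have "?T (n + 1) + (\<Sum>i=Suc 1..<Suc j. ?T (n + i)) = (\<Sum>i=1..<j. ?T (n + i)) + ?T (n + j)"
    using assms sum.atLeast_Suc_lessThan[of 1 "Suc j" "\<lambda>i. ?T (n + i)"] by simp
  ultimately show ?thesis
    using sym_trace_rec[OF assms, of n] sym_trace_rec[OF assms, of "Suc n"] by simp
qed

lemma sym_trace_self:
  assumes "j \<ge> 2"
  shows "sym_trace j j = 3 ^ j - 1 - int j"
proof -
  have "sym_trace j j = 2 * (\<Sum>i=1..<j. 3 ^ i - 1) + int j"
    using sym_trace_rec[OF assms, of 0] assms by (simp add: sym_trace_0 sym_trace_small)
  also have "2 * (\<Sum>i=1..<j. 3 ^ i - (1::int)) = 3 ^ j - 3 - 2 * (int j - 1)"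
    using assms by (induction j rule: nat_induct_at_least) (auto simp: numeral_2_eq_2)
  finally show ?thesis by simp
qed

text \<open>By \<open>sym_trace_rec3\<close>: the subtracted terms lie in the range of
  \<open>sym_trace_small\<close>, apart from the value \<open>int j\<close> at time \<open>0\<close>
  that enters in the base case.\<close>

lemma sym_trace_mid:
  assumes "j \<ge> 2" "k + 1 < j"
  shows "sym_trace j (j + k + 1) = 3 ^ (j + k + 1) - 1 - 4 * int (j + k + 1) * 3 ^ k"
  using assms(2)
proof (induction k)
  case 0
  then show ?case
    using sym_trace_rec3[OF assms(1), of 0] assms
    by (simp add: sym_trace_self sym_trace_0 sym_trace_small)
next
  case (Suc k)
  have "sym_trace j (Suc (Suc k + j)) = 3 * sym_trace j (j + k + 1) - (3 ^ (k + 2) - 1) - (3 ^ (k + 1) - 1)"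
    using sym_trace_rec3[OF assms(1), of "Suc k"] assms Suc.prems
    by (simp add: sym_trace_small ac_simps)
  also have "\<dots> = 3 ^ (j + Suc k + 1) - 1 - 4 * int (j + Suc k + 1) * 3 ^ Suc k"
    using Suc by (simp add: algebra_simps)
  finally show ?case by (simp add: ac_simps)
qed

section \<open>Trace of the antisymmetric part, and the two combined walk counts\<close>

lemma sum_of_bool_residue:
  assumes "j \<ge> 1" "0 \<le> r" "r < int j"
  shows "(\<Sum>k<j. of_bool ((int k - x) mod int j = r)) = (1::int)"
proof -
  define k0 where "k0 = nat ((r + x) mod int j)"
  have k0: "k0 < j" "int k0 = (r + x) mod int j"
    using assms by (auto simp: k0_def nat_less_iff)
  have "(int k - x) mod int j = r \<longleftrightarrow> k = k0" if "k < j" for k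
  proof -
    have "(int k - x) mod int j = r \<longleftrightarrow> (int k - x) mod int j = r mod int j"
      using assms by simp
    also have "\<dots> \<longleftrightarrow> int k mod int j = (r + x) mod int j"
      by (simp add: mod_eq_dvd_iff algebra_simps)
    also have "\<dots> \<longleftrightarrow> k = k0" using that k0 by auto
    finally show ?thesis .
  qed
  then have "(\<Sum>k<j. of_bool ((int k - x) mod int j = r)) = (\<Sum>k<j. of_bool (k = k0) :: int)"
    by (intro sum.cong) auto
  also have "\<dots> = 1" using k0 by simp
  finally show ?thesis .
qed

text \<open>
  Adjoining minus the sum of all entries as an entry \<open>0\<close>, the antisymmetric part evolves by a
  cyclic shift of length \<open>j\<close>.
\<close>

lemma alt_count_eq:
  assumes "j \<ge> 2" "1 \<le> v" "v < j" "1 \<le> u" "u < j"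
  shows "alt_count j (int v) n u
       = of_bool ((int u - int n) mod int j = int v) - of_bool ((int u - int n) mod int j = 0)"
  using assms(4,5)
proof (induction n arbitrary: u)
  case 0
  then show ?case using assms by (auto simp: alt_count_def)
next
  case (Suc n)
  let ?d = "\<lambda>k. of_bool ((int k - int n) mod int j = int v) - of_bool ((int k - int n) mod int j = 0) :: int"
  show ?case
  proof (cases "u = 1")
    case True
    \<comment> \<open>Both residues are hit exactly once by \<open>k < j\<close>, so the adjoined
      entry \<open>?d 0\<close> is minus the sum of the others, which is just what position
      \<open>1\<close> receives.\<close>
    have "?d 0 + (\<Sum>k=1..<j. ?d k) = (\<Sum>k<j. ?d k)"
      using assms by (simp add: sum_lessThan_eq_atLeast1)
    also have "\<dots> = 1 - 1"
      unfolding sum_subtractf using assms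
      by (intro arg_cong2[where f = "(-)"] sum_of_bool_residue) auto
    finally have "?d 0 = - (\<Sum>k=1..<j. alt_count j (int v) n k)"
      using Suc.IH by simp
    then show ?thesis
      using alt_count_Suc_1[of j "int v" n] assms True by simp
  next
    case False
    then have "alt_count j (int v) (Suc n) u = alt_count j (int v) n (u - 1)"
      using Suc by (intro alt_count_Suc_ge2) auto
    then show ?thesis using Suc.IH[of "u - 1"] Suc.prems False by (simp add: of_nat_diff algebra_simps)
  qed
qed

definition alt_trace :: "nat \<Rightarrow> nat \<Rightarrow> int" where
  "alt_trace j n = int j * of_bool (j dvd n) - 1"

lemma sum_alt_count:
  assumes "j \<ge> 2"
  shows "(\<Sum>v=1..<j. alt_count j (int v) n v) = alt_trace j n"
proof -
  have fix_iff: "(int v - int n) mod int j = int v \<longleftrightarrow> j dvd n" if "v < j" for v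
  proof -
    have "(int v - int n) mod int j = int v \<longleftrightarrow> (int v - int n) mod int j = int v mod int j"
      using that by simp
    also have "\<dots> \<longleftrightarrow> j dvd n" by (simp add: mod_eq_dvd_iff)
    finally show ?thesis .
  qed
  define b :: "nat \<Rightarrow> int" where "b v = of_bool ((int v - int n) mod int j = 0)" for v
  have "(\<Sum>v<j. b v) = 1"
    unfolding b_def using assms by (intro sum_of_bool_residue) auto
  moreover have "b 0 = of_bool (j dvd n)"
    using fix_iff[of 0] assms by (simp add: b_def)
  ultimately have "of_bool (j dvd n) + (\<Sum>v=1..<j. b v) = 1"
    using assms by (simp add: sum_lessThan_eq_atLeast1)
  moreover have "(\<Sum>v=1..<j. alt_count j (int v) n v) = (\<Sum>v=1..<j. of_bool (j dvd n) - b v)"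
    using assms by (intro sum.cong) (auto simp: alt_count_eq fix_iff b_def)
  ultimately show ?thesis
    using assms by (simp add: sum_subtractf alt_trace_def of_nat_diff algebra_simps)
qed

text \<open>\<open>?A\<close> counts walks from positive cells to themselves and \<open>?B\<close>
  walks to them from their mirror images. By reflection the two sums are the middle term plus
  \<open>2 * ?A\<close> and plus \<open>2 * ?B\<close>, while the traces are the middle term plus
  \<open>?A + ?B\<close>, and \<open>?A - ?B\<close>.\<close>

lemma
  assumes "j \<ge> 2"
  shows sum_walk_count_closed: "(\<Sum>v\<in>cells j. walk_count j n v v) = sym_trace j n + alt_trace j n"
    and sum_walk_count_reflected: "(\<Sum>v\<in>cells j. walk_count j n v (- v)) = sym_trace j n - alt_trace j n"
proof -
  let ?A = "\<Sum>v=1..<j. walk_count j n (int v) (int v)"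
  let ?B = "\<Sum>v=1..<j. walk_count j n (- int v) (int v)"
  have refl: "walk_count j n u (- v) = walk_count j n (- u) v" for u v
    using walk_count_uminus[of j n "- u" v] by simp
  have "(\<Sum>v\<in>cells j. walk_count j n v v) = walk_count j n 0 0 + 2 * ?A"
    "(\<Sum>v\<in>cells j. walk_count j n v (- v)) = walk_count j n 0 0 + 2 * ?B"
    using assms by (simp_all add: sum_cells refl sum.distrib sum_distrib_left)
  moreover have "sym_trace j n = walk_count j n 0 0 + ?A + ?B"
    using assms by (simp add: sym_trace_def sum_lessThan_eq_atLeast1 sym_count_def sum.distrib)
  moreover have "alt_trace j n = ?A - ?B"
    using assms by (simp add: sum_alt_count[symmetric] alt_count_def sum_subtractf)
  ultimately show "(\<Sum>v\<in>cells j. walk_count j n v v) = sym_trace j n + alt_trace j n"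
    and "(\<Sum>v\<in>cells j. walk_count j n v (- v)) = sym_trace j n - alt_trace j n"
    by simp_all
qed

section \<open>The recurrence of order \<open>2 * j - 1\<close> and its solutions\<close>

lemma sum_triangle:
  fixes F :: "nat \<Rightarrow> int"
  shows "(\<Sum>k<j. \<Sum>i=1..j. F (k + i))
       = (\<Sum>m=1..j. int m * F m) + (\<Sum>m=j+1..<2*j+1. (2 * int j - int m) * F m)"
proof (induction j)
  case (Suc j)
  let ?M = "{j+1..<2*j+1}"
  \<comment> \<open>The square of index pairs grows by a row, a column and a corner; row and column
    both have index sums running through \<open>?M\<close>.\<close>
  have "(\<Sum>k<Suc j. \<Sum>i=1..Suc j. F (k + i))
      = (\<Sum>k<j. \<Sum>i=1..j. F (k + i)) + (\<Sum>k<j. F (k + Suc j)) + (\<Sum>i=1..j. F (j + i)) + F (2 * j + 1)"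
    by (simp add: sum.distrib mult_2)
  also have "(\<Sum>k<j. F (k + Suc j)) = sum F ?M"
    by (rule sum.reindex_bij_witness[of _ "\<lambda>m. m - Suc j" "\<lambda>k. k + Suc j"]) auto
  also have "(\<Sum>i=1..j. F (j + i)) = sum F ?M"
    by (rule sum.reindex_bij_witness[of _ "\<lambda>m. m - j" "\<lambda>k. j + k"]) auto
  finally have L: "(\<Sum>k<Suc j. \<Sum>i=1..Suc j. F (k + i))
      = (\<Sum>k<j. \<Sum>i=1..j. F (k + i)) + 2 * sum F ?M + F (2 * j + 1)" by simp
  let ?g = "\<lambda>m. (2 * int (Suc j) - int m) * F m"
  have "(\<Sum>m=Suc j+1..<2*Suc j+1. ?g m) = (\<Sum>m=Suc j+1..<2*j+2. ?g m)"
    by (simp add: sum.op_ivl_Suc)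
  also have "\<dots> = (\<Sum>m=j+1..<2*j+2. ?g m) - int (Suc j) * F (Suc j)"
    using sum.atLeast_Suc_lessThan[of "j+1" "2*j+2" ?g] by (simp add: algebra_simps)
  also have "(\<Sum>m=j+1..<2*j+2. ?g m) = sum ?g ?M + F (2 * j + 1)"
    by (simp add: sum.op_ivl_Suc)
  also have "sum ?g ?M = (\<Sum>m\<in>?M. (2 * int j - int m) * F m) + 2 * sum F ?M"
    by (simp add: sum_distrib_left sum.distrib[symmetric] algebra_simps)
  finally show ?case using L Suc by simp
qed simp

definition long_sum :: "nat \<Rightarrow> (nat \<Rightarrow> int) \<Rightarrow> nat \<Rightarrow> int" where
  "long_sum j f n = (\<Sum>i=1..j. (2 * int i - 1) * f (n - i))
     + (\<Sum>i=j+1..2*j-1. (4 * int j - 2 * int i - 1) * f (n - i))"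

text \<open>
  In terms of characteristic polynomials this is
  \<open>1 - \<Sum>i\<le>j. (2i-1) z^i - \<Sum>j<i<2j. (4j-2i-1) z^i
    = (1 + z + \<dots> + z^(j-1)) (1 - 2z - \<dots> - 2z^(j-1) - z^j)\<close>.
\<close>

lemma long_sum_eq:
  assumes "j \<ge> 1"
  shows "long_sum j f n = (\<Sum>k<j. 2 * (\<Sum>i=1..<j. f (n - k - i)) + f (n - k - j)) - (\<Sum>k=1..<j. f (n - k))"
proof -
  let ?F = "\<lambda>m. f (n - m)"
  let ?M = "{j+1..<2*j}"
  have tri: "(\<Sum>k<j. \<Sum>i=1..j. ?F (k + i))
      = (\<Sum>m=1..j. int m * ?F m) + (\<Sum>m\<in>?M. (2 * int j - int m) * ?F m)"
    using sum_triangle[of ?F j] assms by (simp add: sum.op_ivl_Suc)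
  have "(\<Sum>k<j. 2 * (\<Sum>i=1..<j. ?F (k + i)) + ?F (k + j))
      = 2 * (\<Sum>k<j. \<Sum>i=1..j. ?F (k + i)) - (\<Sum>k<j. ?F (k + j))"
  proof -
    have "(\<Sum>i=1..j. ?F (k + i)) = (\<Sum>i=1..<j. ?F (k + i)) + ?F (k + j)" for k
      using assms by (cases j) (auto simp: atLeastLessThanSuc_atLeastAtMost)
    then show ?thesis by (simp add: sum.distrib sum_distrib_left)
  qed
  also have "(\<Sum>k<j. ?F (k + j)) = (\<Sum>m=j..<2*j. ?F m)"
    by (rule sum.reindex_bij_witness[of _ "\<lambda>m. m - j" "\<lambda>k. k + j"]) auto
  also have "\<dots> = ?F j + sum ?F ?M"
    using assms by (simp add: sum.atLeast_Suc_lessThan)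
  finally have A: "(\<Sum>k<j. 2 * (\<Sum>i=1..<j. ?F (k + i)) + ?F (k + j))
      = 2 * (\<Sum>m=1..j. int m * ?F m) + 2 * (\<Sum>m\<in>?M. (2 * int j - int m) * ?F m) - ?F j - sum ?F ?M"
    unfolding tri by simp
  have "(\<Sum>m=1..j. ?F m) = (\<Sum>k=1..<j. ?F k) + ?F j"
    using assms by (cases j) (auto simp: atLeastLessThanSuc_atLeastAtMost)
  moreover have "(\<Sum>i=1..j. (2 * int i - 1) * ?F i) = 2 * (\<Sum>m=1..j. int m * ?F m) - (\<Sum>m=1..j. ?F m)"
    by (simp add: sum_distrib_left sum_subtractf[symmetric] algebra_simps)
  moreover have "(\<Sum>i\<in>?M. (4 * int j - 2 * int i - 1) * ?F i)
      = 2 * (\<Sum>m\<in>?M. (2 * int j - int m) * ?F m) - sum ?F ?M"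
    by (simp add: sum_distrib_left sum_subtractf[symmetric] algebra_simps)
  moreover have "{j+1..2*j-1} = ?M" using assms by auto
  ultimately show ?thesis
    unfolding long_sum_def using A by simp
qed

text \<open>In \<open>long_sum_eq\<close> the bracket for each \<open>k\<close> collapses to the
  trace at \<open>n - k\<close> by the short recurrence; the subtracted sum then leaves only
  \<open>k = 0\<close>.\<close>

lemma long_sum_sym_trace:
  assumes "j \<ge> 2" "n \<ge> 2 * j"
  shows "long_sum j (sym_trace j) n = sym_trace j n"
proof -
  have "(\<Sum>k<j. 2 * (\<Sum>i=1..<j. sym_trace j (n - k - i)) + sym_trace j (n - k - j))
      = (\<Sum>k<j. sym_trace j (n - k))"
    using assms by (intro sum.cong refl sym_trace_rec'[symmetric]) auto
  then show ?thesis
    using assms by (simp add: long_sum_eq sum_lessThan_eq_atLeast1)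
qed

text \<open>Exactly one of \<open>j\<close> consecutive integers is divisible by \<open>j\<close>.
  The bound on \<open>m\<close> keeps \<open>m - k\<close> from being truncated.\<close>

lemma sum_alt_trace_window:
  assumes "j \<ge> 1" "m + 1 \<ge> j"
  shows "(\<Sum>k<j. alt_trace j (m - k)) = 0"
proof -
  have "j dvd m - k \<longleftrightarrow> k = m mod j" if "k < j" for k
  proof -
    have "j dvd m - k \<longleftrightarrow> [m = k] (mod j)"
      using that assms by (subst cong_altdef_nat) auto
    then show ?thesis using that by (auto simp: cong_def)
  qed
  then have "(\<Sum>k<j. alt_trace j (m - k)) = (\<Sum>k<j. int j * of_bool (k = m mod j) - 1)"
    unfolding alt_trace_def by (intro sum.cong) auto
  also have "\<dots> = 0"
    using assms by (simp add: sum_subtractf sum_distrib_left[symmetric])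
  finally show ?thesis .
qed

text \<open>Here the other factor does the work: all sums over \<open>j\<close> consecutive values
  vanish.\<close>

lemma long_sum_alt_trace:
  assumes "j \<ge> 2" "n \<ge> 2 * j"
  shows "long_sum j (alt_trace j) n = alt_trace j n"
proof -
  have w: "(\<Sum>k<j. alt_trace j (n - k - i)) = 0" if "i \<le> j" for i
    using sum_alt_trace_window[of j "n - i"] assms that by (simp add: add.commute)
  have "(\<Sum>k<j. \<Sum>i=1..<j. alt_trace j (n - k - i)) = 0"
    by (subst sum.swap) (intro sum.neutral ballI w, simp)
  then have "(\<Sum>k<j. 2 * (\<Sum>i=1..<j. alt_trace j (n - k - i)) + alt_trace j (n - k - j)) = 0"
    using w[of j] by (simp add: sum.distrib sum_distrib_left[symmetric])
  moreover have "alt_trace j n + (\<Sum>k=1..<j. alt_trace j (n - k)) = 0"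
    using sum_alt_trace_window[of j n] assms by (simp add: sum_lessThan_eq_atLeast1)
  ultimately show ?thesis
    using assms by (simp add: long_sum_eq)
qed

text \<open>The bound on \<open>n\<close> keeps every argument \<open>n - i\<close> between
  \<open>1\<close> and \<open>n - 1\<close>, where the induction hypotheses for \<open>phi\<close>
  and \<open>psi\<close> apply.\<close>

lemma long_sum_cong:
  assumes "n \<ge> 2 * j" "\<And>m. 1 \<le> m \<Longrightarrow> m < n \<Longrightarrow> f m = g m"
  shows "long_sum j f n = long_sum j g n"
  unfolding long_sum_def using assms by (intro arg_cong2[where f = "(+)"] sum.cong) auto

lemma long_sum_add: "long_sum j (\<lambda>m. f m + g m) n = long_sum j f n + long_sum j g n"
  by (simp add: long_sum_def distrib_left sum.distrib)

lemma long_sum_diff: "long_sum j (\<lambda>m. f m - g m) n = long_sum j f n - long_sum j g n"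
  by (simp add: long_sum_def right_diff_distrib sum_subtractf)

lemma not_dvd_between:
  fixes j n :: nat
  assumes "j < n" "n < 2 * j"
  shows "\<not> j dvd n"
  using assms by (auto elim!: dvdE)

lemma phi_eq_traces:
  assumes "j \<ge> 2" "n \<ge> 1"
  shows "phi j n = sym_trace j n + alt_trace j n"
  using assms(2)
proof (induction n rule: less_induct)
  case (less n)
  consider "n < j" | "n = j" | "j < n" "n < 2 * j" | "n \<ge> 2 * j" by linarith
  then show ?case
  proof cases
    case 1
    then show ?thesis using assms less.prems
      by (subst phi.simps) (auto simp: sym_trace_small alt_trace_def dest: dvd_imp_le)
  next
    case 2
    then show ?thesis using assms
      by (subst phi.simps) (auto simp: sym_trace_self alt_trace_def)
  next
    case 3
    then have "n = j + (n - j - 1) + 1" by simp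
    then show ?thesis using 3 assms sym_trace_mid[of j "n - j - 1"] not_dvd_between[OF 3]
      by (subst phi.simps) (auto simp: alt_trace_def)
  next
    case 4
    have "phi j n = long_sum j (phi j) n"
      using 4 assms by (subst phi.simps) (auto simp: long_sum_def)
    also have "\<dots> = long_sum j (\<lambda>m. sym_trace j m + alt_trace j m) n"
      using 4 less.IH by (intro long_sum_cong) auto
    finally show ?thesis
      using assms 4 by (simp add: long_sum_add long_sum_sym_trace long_sum_alt_trace)
  qed
qed

lemma psi_eq_traces:
  assumes "j \<ge> 2" "n \<ge> 1"
  shows "psi j n = sym_trace j n - alt_trace j n"
  using assms(2)
proof (induction n rule: less_induct)
  case (less n)
  consider "n < j" | "n = j" | "j < n" "n < 2 * j" | "n \<ge> 2 * j" by linarith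
  then show ?case
  proof cases
    case 1
    then show ?thesis using assms less.prems
      by (subst psi.simps) (auto simp: sym_trace_small alt_trace_def dest: dvd_imp_le)
  next
    case 2
    then show ?thesis using assms
      by (subst psi.simps) (auto simp: sym_trace_self alt_trace_def)
  next
    case 3
    then have "n = j + (n - j - 1) + 1" by simp
    then show ?thesis using 3 assms sym_trace_mid[of j "n - j - 1"] not_dvd_between[OF 3]
      by (subst psi.simps) (auto simp: alt_trace_def)
  next
    case 4
    have "psi j n = long_sum j (psi j) n"
      using 4 assms by (subst psi.simps) (auto simp: long_sum_def)
    also have "\<dots> = long_sum j (\<lambda>m. sym_trace j m - alt_trace j m) n"
      using 4 less.IH by (intro long_sum_cong) auto
    finally show ?thesis
      using assms 4 by (simp add: long_sum_diff long_sum_sym_trace long_sum_alt_trace)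
  qed
qed

section \<open>Walks and solutions\<close>

fun walks :: "nat \<Rightarrow> nat \<Rightarrow> int \<Rightarrow> int \<Rightarrow> int list set" where
  "walks j 0 u v = (if u = v then {[u]} else {})"
| "walks j (Suc n) u v = (\<Union>w\<in>succs j u. (#) u ` walks j n w v)"

lemma finite_succs: "finite (succs j v)"
  by (simp add: succs_def cells_def)

lemma succs_subset_cells: "j \<ge> 2 \<Longrightarrow> v \<in> cells j \<Longrightarrow> succs j v \<subseteq> cells j"
  by (auto simp: succs_def cells_def)

lemma walks_hd: "xs \<in> walks j n u v \<Longrightarrow> xs ! 0 = u"
  by (cases n) (auto split: if_splits)

lemma finite_walks: "finite (walks j n u v)"
  by (induction n arbitrary: u) (auto simp: finite_succs)

lemma card_walks: "int (card (walks j n u v)) = walk_count j n u v"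
proof (induction n arbitrary: u)
  case (Suc n)
  have "card (walks j (Suc n) u v) = (\<Sum>w\<in>succs j u. card ((#) u ` walks j n w v))"
    unfolding walks.simps
    by (rule card_UN_disjoint) (auto simp: finite_succs finite_walks dest: walks_hd)
  also have "\<dots> = (\<Sum>w\<in>succs j u. card (walks j n w v))"
    by (intro sum.cong refl card_image) auto
  finally show ?case by (simp add: Suc)
qed simp

lemma walks_iff:
  "xs \<in> walks j n u v \<longleftrightarrow>
     length xs = Suc n \<and> xs ! 0 = u \<and> xs ! n = v \<and> (\<forall>k<n. xs ! Suc k \<in> succs j (xs ! k))"
proof (induction n arbitrary: u xs)
  case 0
  then show ?case by (cases xs) auto
next
  case (Suc n)
  show ?case
  proof (cases xs)
    case (Cons a ys)
    have "xs \<in> walks j (Suc n) u v \<longleftrightarrow> a = u \<and> (\<exists>w\<in>succs j u. ys \<in> walks j n w v)"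
      using Cons by auto
    also have "\<dots> \<longleftrightarrow> a = u \<and> length ys = Suc n \<and> ys ! 0 \<in> succs j u \<and> ys ! n = v
        \<and> (\<forall>k<n. ys ! Suc k \<in> succs j (ys ! k))"
      unfolding Suc by auto
    also have "\<dots> \<longleftrightarrow> length xs = Suc (Suc n) \<and> xs ! 0 = u \<and> xs ! Suc n = v
        \<and> (\<forall>k<Suc n. xs ! Suc k \<in> succs j (xs ! k))"
      using Cons by (auto simp: All_less_Suc2)
    finally show ?thesis .
  qed auto
qed

lemma walks_nth_cells:
  assumes "j \<ge> 2" "u \<in> cells j" "xs \<in> walks j n u v" "k \<le> n"
  shows "xs ! k \<in> cells j"
  using assms(4)
proof (induction k)
  case 0
  then show ?case using assms walks_hd by auto
next
  case (Suc k)
  then show ?case using assms succs_subset_cells[of j "xs ! k"] by (auto simp: walks_iff)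
qed

section \<open>Cells of the interval and the action of \<open>g_map\<close> on them\<close>

text \<open>
  The cells are the intervals \<open>[v-1, v)\<close> for \<open>v < 0\<close>, \<open>[-1, 1]\<close> for \<open>v = 0\<close> and \<open>(v, v+1]\<close> for
  \<open>v > 0\<close>. With this choice of half-open intervals the endpoint missing from cell \<open>v\<close> is \<open>v\<close> itself, and
  the periodic orbit of the integers \<open>\<plusminus>1, \<dots>, \<plusminus>j\<close> sees every integer from the side to which it is attached.
\<close>

definition cell_of :: "real \<Rightarrow> int" where
  "cell_of x = (if x > 1 then \<lceil>x\<rceil> - 1 else if x < -1 then \<lfloor>x\<rfloor> + 1 else 0)"

definition closed_cell :: "int \<Rightarrow> real set" where
  "closed_cell v =
     (if v > 0 then {of_int v..of_int v + 1}
      else if v < 0 then {of_int v - 1..of_int v} else {-1..1})"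

lemma cell_of_uminus: "cell_of (- x) = - cell_of x"
  by (auto simp: cell_of_def ceiling_minus floor_minus)

lemma mem_closed_cell_cell_of: "x \<in> closed_cell (cell_of x)"
  unfolding closed_cell_def cell_of_def by (auto split: if_splits) linarith+

lemma cell_of_closed_cell:
  assumes "x \<in> closed_cell v" "v = 0 \<or> x \<noteq> of_int v"
  shows "cell_of x = v"
proof -
  consider "v > 0" | "v < 0" | "v = 0" by linarith
  then show ?thesis
  proof cases
    case 1
    then have "of_int v < x" "x \<le> of_int v + 1" "1 \<le> real_of_int v"
      using assms by (auto simp: closed_cell_def)
    then have "\<lceil>x\<rceil> = v + 1" "x > 1" by (auto simp: ceiling_eq_iff)
    then show ?thesis by (simp add: cell_of_def)
  next
    case 2
    then have "of_int v - 1 \<le> x" "x < of_int v" "real_of_int v \<le> -1"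
      using assms by (auto simp: closed_cell_def)
    then have "\<lfloor>x\<rfloor> = v - 1" "x < -1" by (auto simp: floor_eq_iff)
    then show ?thesis by (simp add: cell_of_def)
  qed (use assms in \<open>auto simp: closed_cell_def cell_of_def\<close>)
qed

lemma cell_of_mem_cells: "x \<in> {- real j..real j} \<Longrightarrow> j \<ge> 2 \<Longrightarrow> cell_of x \<in> cells j"
  unfolding cell_of_def cells_def by (auto split: if_splits) linarith+

lemma closed_cell_subset: "v \<in> cells j \<Longrightarrow> j \<ge> 2 \<Longrightarrow> closed_cell v \<subseteq> {- real j..real j}"
  unfolding closed_cell_def cells_def by (auto split: if_splits)

lemma g_map_closed_cell:
  assumes "x \<in> closed_cell v"
  shows "g_map j x =
    (if v \<ge> 2 then x - 1 else if v = 1 then (1 + real j) * (x - 1) - real j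
     else if v = 0 then - (real j * x) else if v = -1 then (1 + real j) * (x + 1) + real j
     else x + 1)"
proof -
  consider "v \<ge> 2" | "v = 1" | "v = 0" | "v = -1" | "v \<le> -2" by linarith
  then show ?thesis
  proof cases
    case 1
    then have "2 \<le> real_of_int v" by simp
    with 1 show ?thesis using assms by (simp add: closed_cell_def g_map_right)
  next
    case 5
    then have "real_of_int v \<le> -2" by simp
    with 5 show ?thesis using assms by (simp add: closed_cell_def g_map_left)
  qed (use assms in \<open>auto simp: closed_cell_def g_map_affine affine_interp_def field_simps\<close>)
qed

lemma g_map_uminus: "g_map j (- x) = - g_map j x"
  using g_map_closed_cell[OF mem_closed_cell_cell_of, of j x]
    g_map_closed_cell[OF mem_closed_cell_cell_of, of j "- x"]
  by (auto simp: cell_of_uminus algebra_simps split: if_splits)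

lemma cell_of_g_map:
  assumes "j \<ge> 2" "x \<in> {- real j..real j}"
  shows "cell_of (g_map j x) \<in> succs j (cell_of x)"
proof -
  have pos: "cell_of (g_map j x) \<in> succs j (cell_of x)"
    if x: "x \<in> {- real j..real j}" and v: "cell_of x \<ge> 0" for x
  proof -
    have g: "cell_of (g_map j x) \<in> cells j"
      using g_map_self_map[OF assms(1) x] assms by (intro cell_of_mem_cells) auto
    consider "cell_of x \<ge> 2" | "cell_of x = 1" | "cell_of x = 0" using v by linarith
    then show ?thesis
    proof cases
      case 1
      then have "x > 2" "cell_of x = \<lceil>x\<rceil> - 1"
        by (auto simp: cell_of_def split: if_splits; linarith)+
      then show ?thesis using 1 by (simp add: g_map_right succs_def cell_of_def)
    next
      case 2
      then have x12: "1 < x" "x \<le> 2"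
        by (auto simp: cell_of_def split: if_splits; linarith)+
      have "x \<in> closed_cell 1" using mem_closed_cell_cell_of[of x] 2 by simp
      then have "g_map j x = (1 + real j) * (x - 1) - real j" by (simp add: g_map_closed_cell)
      moreover have "(1 + real j) * (x - 1) \<le> 1 + real j"
        using x12 by (intro mult_left_le) auto
      ultimately have "g_map j x \<le> 1" by linarith
      then have "cell_of (g_map j x) \<le> 0" by (auto simp: cell_of_def; linarith)
      with g 2 show ?thesis by (auto simp: succs_def cells_def)
    next
      case 3
      with g show ?thesis by (simp add: succs_def)
    qed
  qed
  show ?thesis
  proof (cases "cell_of x \<ge> 0")
    case False
    then have "cell_of (g_map j (- x)) \<in> succs j (cell_of (- x))"
      using assms by (intro pos) (auto simp: cell_of_uminus)
    then show ?thesis by (auto simp: cell_of_uminus g_map_uminus succs_uminus)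
  qed (use pos assms in auto)
qed

text \<open>On the closed cell \<open>v\<close> the map is affine with an image containing the
  closed cell \<open>w\<close>, so \<open>h\<close> is the inverse of that affine formula.\<close>

lemma g_map_inverse_branch:
  assumes "j \<ge> 2" "v \<in> cells j" "w \<in> succs j v"
  obtains h where "continuous_on UNIV h"
    "\<And>z. z \<in> closed_cell w \<Longrightarrow> h z \<in> closed_cell v \<and> g_map j (h z) = z"
proof -
  have sub: "closed_cell w \<subseteq> {- real j..real j}"
    using assms succs_subset_cells closed_cell_subset by blast
  have j: "real j \<ge> 2" using assms by simp
  consider "v \<ge> 2" | "v = 1" | "v = 0" | "v = -1" | "v \<le> -2" by linarith
  then show ?thesis
  proof cases
    case 1
    with assms have "w = v - 1" by (simp add: succs_def)
    with 1 have mem: "z + 1 \<in> closed_cell v" if "z \<in> closed_cell w" for z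
      using that by (auto simp: closed_cell_def)
    show ?thesis
      by (rule that[of "\<lambda>z. z + 1"])
         (use 1 in \<open>auto intro!: continuous_intros simp: mem g_map_closed_cell[OF mem]\<close>)
  next
    case 2
    with assms have w: "w \<le> 0" by (simp add: succs_def)
    have mem: "1 + (z + real j) / (1 + real j) \<in> closed_cell v" if z: "z \<in> closed_cell w" for z
    proof -
      have "z \<le> 1" using z w by (auto simp: closed_cell_def split: if_splits)
      moreover have "- real j \<le> z" using z sub by auto
      ultimately show ?thesis using 2 j by (auto simp: closed_cell_def field_simps)
    qed
    show ?thesis
      by (rule that[of "\<lambda>z. 1 + (z + real j) / (1 + real j)"])
         (use 2 in \<open>auto intro!: continuous_intros simp: mem[unfolded 2] g_map_closed_cell[OF mem[unfolded 2]] add_eq_0_iff\<close>)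
  next
    case 3
    have mem: "- (z / real j) \<in> closed_cell v" if z: "z \<in> closed_cell w" for z
    proof -
      have "- real j \<le> z" "z \<le> real j" using z sub by auto
      then show ?thesis using 3 j by (auto simp: closed_cell_def field_simps)
    qed
    show ?thesis
      by (rule that[of "\<lambda>z. - (z / real j)"])
         (use 3 j in \<open>auto intro!: continuous_intros simp: mem[unfolded 3] g_map_closed_cell[OF mem[unfolded 3]]\<close>)
  next
    case 4
    with assms have w: "w \<ge> 0" by (simp add: succs_def)
    have mem: "(z - real j) / (1 + real j) - 1 \<in> closed_cell v" if z: "z \<in> closed_cell w" for z
    proof -
      have "-1 \<le> z" using z w by (auto simp: closed_cell_def split: if_splits)
      moreover have "z \<le> real j" using z sub by auto
      ultimately show ?thesis using 4 j by (auto simp: closed_cell_def field_simps)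
    qed
    show ?thesis
      by (rule that[of "\<lambda>z. (z - real j) / (1 + real j) - 1"])
         (use 4 in \<open>auto intro!: continuous_intros simp: mem[unfolded 4] g_map_closed_cell[OF mem[unfolded 4]] add_eq_0_iff\<close>)
  next
    case 5
    with assms have "w = v + 1" by (simp add: succs_def)
    with 5 have mem: "z - 1 \<in> closed_cell v" if "z \<in> closed_cell w" for z
      using that by (auto simp: closed_cell_def)
    show ?thesis
      by (rule that[of "\<lambda>z. z - 1"])
         (use 5 in \<open>auto intro!: continuous_intros simp: mem g_map_closed_cell[OF mem]\<close>)
  qed
qed

text \<open>Pulling \<open>c\<close> back along an inverse branch of the first step reduces to a shorter walk.\<close>

lemma walk_realized:
  assumes "j \<ge> 2" "u \<in> cells j" "xs \<in> walks j n u v"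
    and "continuous_on (closed_cell u) c" "c \<in> closed_cell u \<rightarrow> closed_cell v"
  shows "\<exists>y\<in>closed_cell u. (g_map j ^^ n) y = c y \<and> (\<forall>k\<le>n. (g_map j ^^ k) y \<in> closed_cell (xs ! k))"
  using assms(2-)
proof (induction n arbitrary: u xs c)
  case 0
  then have "u = v" "xs = [u]" by (auto split: if_splits)
  \<comment> \<open>For a walk of length \<open>0\<close>, \<open>c\<close> maps a compact interval
    to itself and hence has a fixed point.\<close>
  have "compact (closed_cell u)" "convex (closed_cell u)" "closed_cell u \<noteq> {}"
    by (auto simp: closed_cell_def)
  then obtain y where "y \<in> closed_cell u" "c y = y"
    using brouwer[of "closed_cell u" c] 0 \<open>u = v\<close> by metis
  then show ?case using \<open>xs = [u]\<close> by (intro bexI[of _ y]) auto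
next
  case (Suc n)
  from Suc.prems obtain w ys where w: "w \<in> succs j u" and ys: "ys \<in> walks j n w v" "xs = u # ys"
    by auto
  obtain h where h: "continuous_on UNIV h"
    "\<And>z. z \<in> closed_cell w \<Longrightarrow> h z \<in> closed_cell u \<and> g_map j (h z) = z"
    using g_map_inverse_branch[OF assms(1) Suc.prems(1) w] by blast
  have w_cell: "w \<in> cells j" using w succs_subset_cells[OF assms(1) Suc.prems(1)] by blast
  have cont: "continuous_on (closed_cell w) (\<lambda>z. c (h z))"
    by (rule continuous_on_compose2[OF Suc.prems(3) continuous_on_subset[OF h(1) subset_UNIV]])
       (use h(2) in auto)
  have maps: "(\<lambda>z. c (h z)) \<in> closed_cell w \<rightarrow> closed_cell v"
    using h(2) Suc.prems(4) by (auto simp: Pi_iff)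
  obtain z where z: "z \<in> closed_cell w" "(g_map j ^^ n) z = c (h z)"
    "\<And>k. k \<le> n \<Longrightarrow> (g_map j ^^ k) z \<in> closed_cell (ys ! k)"
    using Suc.IH[OF w_cell ys(1) cont maps] by blast
  have shift: "(g_map j ^^ Suc k) (h z) = (g_map j ^^ k) z" for k
    unfolding funpow_Suc_right using h z by simp
  have "(g_map j ^^ k) (h z) \<in> closed_cell (xs ! k)" if "k \<le> Suc n" for k
  proof (cases k)
    case 0
    then show ?thesis using h z ys by simp
  next
    case (Suc i)
    then show ?thesis using shift[of i] z(3)[of i] that ys by simp
  qed
  then show ?case
    using h z shift[of n] by (intro bexI[of _ "h z"] conjI) auto
qed

text \<open>Neighbouring closed cells meet only in nonzero integers, so these are the points with
  ambiguous itineraries; their orbits never leave the nonzero integers.\<close>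

lemma g_map_integer:
  assumes "j \<ge> 2" "x \<in> {- real j..real j}" "x \<in> \<int>" "x \<noteq> 0"
  shows "g_map j x \<in> \<int> \<and> g_map j x \<noteq> 0"
proof -
  obtain i where i: "x = of_int i" using assms by (auto elim: Ints_cases)
  have "i \<noteq> 0" using assms i by auto
  then consider "i \<le> -2" | "i = -1" | "i = 1" | "i \<ge> 2" by linarith
  then show ?thesis
  proof cases
    case 1
    then have "real_of_int i \<le> -2" by simp
    then show ?thesis using i by (auto simp: g_map_left)
  next
    case 4
    then have "2 \<le> real_of_int i" by simp
    then show ?thesis using i by (auto simp: g_map_right)
  qed (use i assms in \<open>auto simp: g_map_one g_map_minus_one\<close>)
qed

text \<open>Traces a missing endpoint backwards. The integer endpoints of cells \<open>-1\<close>,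
  \<open>0\<close> and \<open>1\<close> go to \<open>j\<close>, \<open>-j\<close> or to an endpoint
  on the side that \<open>w\<close> cannot lie on, so only the translating cells remain.\<close>

lemma missing_endpoint_step:
  assumes "j \<ge> 2" "v \<in> cells j" "w \<in> succs j v"
    and y: "y \<in> closed_cell v" "y \<in> \<int>" "y \<noteq> 0" and "w \<noteq> 0" "g_map j y = of_int w"
  shows "v \<noteq> 0 \<and> y = of_int v \<and> \<bar>w\<bar> = \<bar>v\<bar> - 1"
proof -
  obtain i where i: "y = of_int i" using y by (auto elim: Ints_cases)
  note g = g_map_closed_cell[OF y(1), of j]
  have w: "\<bar>w\<bar> \<le> int j - 1"
    using subsetD[OF succs_subset_cells[OF assms(1,2)] assms(3)] by (auto simp: cells_def)
  consider "v \<ge> 2" | "v = 1" | "v = 0" | "v = -1" | "v \<le> -2" by linarith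
  then show ?thesis
  proof cases
    case 1
    with assms g show ?thesis by (auto simp: succs_def)
  next
    case 2
    then have "i = 1 \<or> i = 2" using y i by (auto simp: closed_cell_def)
    then have "real_of_int w = - real j \<or> real_of_int w = 1"
      using g i 2 assms by auto
    then have "w = - int j \<or> w = 1" by linarith
    with w 2 assms show ?thesis by (auto simp: succs_def)
  next
    case 3
    then have "i = 1 \<or> i = -1" using y i by (auto simp: closed_cell_def)
    then have "real_of_int w = - real j \<or> real_of_int w = real j"
      using g i 3 assms by auto
    then have "w = - int j \<or> w = int j" by linarith
    with w show ?thesis by auto
  next
    case 4
    then have "i = -1 \<or> i = -2" using y i by (auto simp: closed_cell_def)
    then have "real_of_int w = real j \<or> real_of_int w = -1"
      using g i 4 assms by auto
    then have "w = int j \<or> w = -1" by linarith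
    with w 4 assms show ?thesis by (auto simp: succs_def)
  next
    case 5
    with assms g show ?thesis by (auto simp: succs_def)
  qed
qed

section \<open>Itineraries: solutions correspond to walks\<close>

definition itinerary :: "nat \<Rightarrow> nat \<Rightarrow> real \<Rightarrow> int list" where
  "itinerary j n x = map (\<lambda>k. cell_of ((g_map j ^^ k) x)) [0..<Suc n]"

lemma length_itinerary: "length (itinerary j n x) = Suc n"
  by (simp add: itinerary_def)

lemma itinerary_nth: "k \<le> n \<Longrightarrow> itinerary j n x ! k = cell_of ((g_map j ^^ k) x)"
  unfolding itinerary_def by (subst nth_map) (auto simp del: upt_Suc)

lemma funpow_g_map_mem:
  assumes "j \<ge> 2" "x \<in> {- real j..real j}"
  shows "(g_map j ^^ k) x \<in> {- real j..real j}"
proof (induction k)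
  case (Suc k)
  then show ?case using g_map_self_map[OF assms(1)] by simp
qed (use assms in simp)

lemma itinerary_in_walks:
  assumes "j \<ge> 2" "x \<in> {- real j..real j}"
  shows "itinerary j n x \<in> walks j n (cell_of x) (cell_of ((g_map j ^^ n) x))"
  unfolding walks_iff
  using cell_of_g_map[OF assms(1) funpow_g_map_mem[OF assms]]
  by (auto simp: itinerary_nth length_itinerary)

lemma g_map_expanding:
  assumes "j \<ge> 2" "cell_of x = cell_of y"
  shows "\<bar>g_map j x - g_map j y\<bar> \<ge> \<bar>x - y\<bar>"
    and "\<bar>cell_of x\<bar> \<le> 1 \<Longrightarrow> \<bar>g_map j x - g_map j y\<bar> \<ge> 2 * \<bar>x - y\<bar>"
proof -
  let ?v = "cell_of x"
  have "g_map j x - g_map j y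
      = (if ?v \<ge> 2 then 1 else if ?v = 1 then 1 + real j else if ?v = 0 then - real j
         else if ?v = -1 then 1 + real j else 1) * (x - y)"
    using mem_closed_cell_cell_of[of x] mem_closed_cell_cell_of[of y] assms
    by (simp add: g_map_closed_cell[of x ?v] g_map_closed_cell[of y ?v] algebra_simps)
  moreover define a where "a = (if \<bar>?v\<bar> > 1 then 1 else if ?v = 0 then real j else 1 + real j)"
  ultimately have eq: "\<bar>g_map j x - g_map j y\<bar> = a * \<bar>x - y\<bar>"
    by (auto simp: abs_mult)
  show "\<bar>g_map j x - g_map j y\<bar> \<ge> \<bar>x - y\<bar>"
    unfolding eq using assms mult_right_mono[of 1 a "\<bar>x - y\<bar>"] by (auto simp: a_def)
  show "\<bar>cell_of x\<bar> \<le> 1 \<Longrightarrow> \<bar>g_map j x - g_map j y\<bar> \<ge> 2 * \<bar>x - y\<bar>"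
    unfolding eq using assms by (intro mult_right_mono) (auto simp: a_def)
qed

text \<open>Expansion gives injectivity. For surjectivity, \<open>walk_realized\<close> yields a
  point whose orbit follows the walk through closed cells, and it remains to exclude the missing
  endpoints. The sign \<open>s\<close> treats both equations at once.\<close>

lemma bij_betw_itinerary:
  fixes s :: int
  assumes j: "j \<ge> 2" and n: "n \<ge> 1" and s: "\<bar>s\<bar> = 1" and v: "v \<in> cells j"
  shows "bij_betw (itinerary j n)
    {x \<in> {- real j..real j}. cell_of x = v \<and> (g_map j ^^ n) x = of_int s * x} (walks j n v (s * v))"
    (is "bij_betw _ ?S _")
proof -
  let ?g = "g_map j"
  have s': "s = 1 \<or> s = -1" using s by linarith
  have cs: "cell_of (of_int s * x) = s * cell_of x" for x
    using s' by (auto simp: cell_of_uminus)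
  have inj: "inj_on (itinerary j n) ?S"
  proof (rule inj_onI)
    fix x y assume x: "x \<in> ?S" and y: "y \<in> ?S" and eq: "itinerary j n x = itinerary j n y"
    let ?d = "\<lambda>k. \<bar>(?g ^^ k) x - (?g ^^ k) y\<bar>"
    let ?c = "\<lambda>k. cell_of ((?g ^^ k) x)"
    have c: "?c k = cell_of ((?g ^^ k) y)" if "k \<le> n" for k
      using itinerary_nth[OF that] eq by metis
    have step: "?d k \<le> ?d (Suc k)" if "k < n" for k
      using g_map_expanding(1)[OF j c[of k]] that by simp
    \<comment> \<open>Otherwise every step lowers the absolute value of the cell by one, although
      the last cell is \<open>s\<close> times the first.\<close>
    have "\<exists>k<n. \<bar>?c k\<bar> \<le> 1"
    proof (rule ccontr)
      assume no: "\<not> ?thesis"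
      have "\<bar>?c k\<bar> = \<bar>?c 0\<bar> - int k" if "k \<le> n" for k
        using that
      proof (induction k)
        case (Suc k)
        have "?c (Suc k) \<in> succs j (?c k)"
          using cell_of_g_map[OF j funpow_g_map_mem[OF j]] x by simp
        moreover have "\<bar>?c k\<bar> > 1" using no Suc.prems by (auto simp: not_le Suc_le_eq)
        ultimately have "\<bar>?c (Suc k)\<bar> = \<bar>?c k\<bar> - 1" by (auto simp: succs_def split: if_splits)
        then show ?case using Suc by simp
      qed simp
      from this[of n] n x s' show False by (auto simp: cs cell_of_uminus)
    qed
    then obtain k where k: "k < n" "\<bar>?c k\<bar> \<le> 1" by blast
    have mono: "?d a \<le> ?d b" if "a \<le> b" "b \<le> n" for a b
      using that by (induction b rule: dec_induct) (use step in \<open>auto intro: order_trans\<close>)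
    \<comment> \<open>The distance never shrinks and doubles at time \<open>k\<close>, yet at time
      \<open>n\<close> it is back at its initial value; so it is zero.\<close>
    have "2 * ?d 0 \<le> 2 * ?d k" using mono[of 0 k] k by simp
    also have "\<dots> \<le> ?d (Suc k)" using g_map_expanding(2)[OF j c[of k]] k by simp
    also have "\<dots> \<le> ?d n" using mono[of "Suc k" n] k by simp
    also have "\<dots> = ?d 0" using x y s' by auto
    finally show "x = y" by simp
  qed
  have sub: "itinerary j n ` ?S \<subseteq> walks j n v (s * v)"
  proof clarify
    fix x assume "x \<in> {- real j..real j}" "v = cell_of x" "(?g ^^ n) x = of_int s * x"
    then show "itinerary j n x \<in> walks j n (cell_of x) (s * cell_of x)"
      using itinerary_in_walks[OF j, of x n] by (simp add: cs)
  qed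
  have "xs \<in> itinerary j n ` ?S" if xs: "xs \<in> walks j n v (s * v)" for xs
  proof -
    have "(\<lambda>x. of_int s * x) \<in> closed_cell v \<rightarrow> closed_cell (s * v)"
      using s' by (auto simp: closed_cell_def split: if_splits)
    moreover have "continuous_on (closed_cell v) (\<lambda>x. of_int s * x)"
      by (intro continuous_intros)
    ultimately obtain y where y: "y \<in> closed_cell v" "(?g ^^ n) y = of_int s * y"
      "\<And>k. k \<le> n \<Longrightarrow> (?g ^^ k) y \<in> closed_cell (xs ! k)"
      using walk_realized[OF j v xs] by blast
    have yj: "y \<in> {- real j..real j}" using closed_cell_subset[OF v j] y by blast
    have ends: "xs ! 0 = v" "xs ! n = s * v" "\<And>k. k < n \<Longrightarrow> xs ! Suc k \<in> succs j (xs ! k)"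
      "length xs = Suc n"
      using xs by (auto simp: walks_iff)
    define missing where "missing k \<longleftrightarrow> xs ! k \<noteq> 0 \<and> (?g ^^ k) y = of_int (xs ! k)" for k
    have "\<not> missing k" if "k \<le> n" for k
    proof
      assume miss: "missing k"
      \<comment> \<open>From time \<open>k\<close> on the orbit consists of nonzero integers. At
        time \<open>n\<close> it is at \<open>y\<close> or \<open>- y\<close>, so \<open>y\<close>
        and its whole orbit are nonzero integers too.\<close>
      have later: "(?g ^^ i) y \<in> \<int> \<and> (?g ^^ i) y \<noteq> 0" if "k \<le> i" for i
        using that
      proof (induction i rule: dec_induct)
        case base
        then show ?case using miss by (auto simp: missing_def)
      next
        case (step i)
        then show ?case using g_map_integer[OF j funpow_g_map_mem[OF j yj]] by auto
      qed
      from later[OF \<open>k \<le> n\<close>] y(2) s' have y0: "y \<in> \<int>" "y \<noteq> 0"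
        by (auto simp: minus_in_Ints_iff)
      have int: "(?g ^^ i) y \<in> \<int> \<and> (?g ^^ i) y \<noteq> 0" for i
      proof (induction i)
        case (Suc i)
        then show ?case using g_map_integer[OF j funpow_g_map_mem[OF j yj]] by auto
      qed (use y0 in auto)
      have pull: "missing i \<and> \<bar>xs ! Suc i\<bar> = \<bar>xs ! i\<bar> - 1" if "missing (Suc i)" "i < n" for i
        using missing_endpoint_step[OF j walks_nth_cells[OF j v xs, of i] ends(3)[of i] y(3)[of i]] int[of i] that
        by (auto simp: missing_def)
      have down: "missing 0 \<and> \<bar>xs ! i\<bar> = \<bar>xs ! 0\<bar> - int i" if "missing i" "i \<le> n" for i
        using that
      proof (induction i)
        case (Suc i)
        then show ?case using pull[of i] by auto
      qed simp
      \<comment> \<open>The missing endpoint is pulled back to time \<open>0\<close> and carried to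
        time \<open>n\<close> by the equation for \<open>y\<close>. Descending from \<open>n\<close>
        then makes the cell's absolute value drop by \<open>n \<ge> 1\<close> between two cells
        equal up to sign.\<close>
      have "missing 0" using down[OF miss \<open>k \<le> n\<close>] by blast
      then have "missing n" using y(2) ends s' by (auto simp: missing_def)
      from down[OF this] n ends s' show False by auto
    qed
    then have cell: "cell_of ((?g ^^ k) y) = xs ! k" if "k \<le> n" for k
      using that y(3)[of k] by (intro cell_of_closed_cell) (auto simp: missing_def)
    then have "itinerary j n y = xs"
      using ends by (intro nth_equalityI) (auto simp: itinerary_nth length_itinerary less_Suc_eq_le)
    moreover have "y \<in> ?S" using yj y cell[of 0] ends by auto
    ultimately show ?thesis by blast
  qed
  with inj sub show ?thesis unfolding bij_betw_def by blast
qed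

lemma card_solutions:
  fixes s :: int
  assumes j: "j \<ge> 2" and n: "n \<ge> 1" and s: "\<bar>s\<bar> = 1"
  defines "S \<equiv> {x \<in> {- real j..real j}. (g_map j ^^ n) x = of_int s * x}"
  shows "finite S" "int (card S) = (\<Sum>v\<in>cells j. walk_count j n v (s * v))"
proof -
  define R where
    "R v = {x \<in> {- real j..real j}. cell_of x = v \<and> (g_map j ^^ n) x = of_int s * x}" for v
  have S: "S = (\<Union>v\<in>cells j. R v)"
    using cell_of_mem_cells[OF _ j] by (auto simp: S_def R_def)
  have fin: "finite (R v)" and card: "int (card (R v)) = walk_count j n v (s * v)" if "v \<in> cells j" for v
    using bij_betw_itinerary[OF j n s that, folded R_def] finite_walks[of j n v "s * v"] card_walks[of j n v "s * v"]
    by (auto simp: bij_betw_finite bij_betw_same_card)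
  have fc: "finite (cells j)" by (simp add: cells_def)
  show "finite S" unfolding S using fin fc by blast
  have "card S = (\<Sum>v\<in>cells j. card (R v))"
    unfolding S using fin fc by (intro card_UN_disjoint) (auto simp: R_def)
  then show "int (card S) = (\<Sum>v\<in>cells j. walk_count j n v (s * v))"
    by (simp add: card)
qed

section \<open>Inclusion--exclusion and least periods\<close>

text \<open>Expansion of the product of \<open>(-1) + 1\<close> over \<open>A\<close>.\<close>

lemma sum_alternating_Pow:
  assumes "finite A"
  shows "(\<Sum>S\<in>Pow A. (-1) ^ card S) = (of_bool (A = {}) :: int)"
proof -
  have "(\<Sum>S\<in>Pow A. (-1) ^ card S) = (\<Prod>a\<in>A. (-1) + (1::int))"
    using assms by (subst prod_add) (auto simp: prod.If_cases)
  also have "\<dots> = of_bool (A = {})"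
    using assms by (auto simp: prod_constant)
  finally show ?thesis .
qed

lemma prod_primes_dvd_iff:
  fixes m :: nat
  assumes "finite S" "\<And>p. p \<in> S \<Longrightarrow> prime p"
  shows "\<Prod>S dvd m \<longleftrightarrow> (\<forall>p\<in>S. p dvd m)"
proof
  assume "\<Prod>S dvd m"
  then show "\<forall>p\<in>S. p dvd m"
    using dvd_prodI[OF assms(1), of _ "\<lambda>p. p"] by (auto intro: dvd_trans)
next
  assume "\<forall>p\<in>S. p dvd m"
  with assms show "\<Prod>S dvd m"
  proof (induction S rule: finite_induct)
    case (insert p S)
    have "coprime p (\<Prod>S)"
      using insert by (intro prod_coprime_right) (metis insertCI primes_coprime)
    then show ?case
      using insert by (simp add: divides_mult)
  qed simp
qed

text \<open>A point \<open>x\<close> is counted for exactly those \<open>S\<close> that consist of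
  primes of \<open>P\<close> dividing \<open>n div r x\<close>. The signs cancel unless there is no
  such prime, that is, unless \<open>r x = n\<close>. Leaving \<open>P\<close> general covers all
  prime divisors as well as only the odd ones.\<close>

lemma alternating_sum_card_periods:
  fixes n :: nat and r :: "'a \<Rightarrow> nat"
  assumes "n > 0" "finite X" "finite P"
    and P: "\<And>p. p \<in> P \<Longrightarrow> prime p \<and> p dvd n"
    and r: "\<And>x. x \<in> X \<Longrightarrow> r x dvd n \<and> (r x = n \<or> (\<exists>p\<in>P. p dvd n div r x))"
  shows "(\<Sum>S\<in>Pow P. (-1) ^ card S * int (card {x \<in> X. r x dvd n div \<Prod>S}))
         = int (card {x \<in> X. r x = n})"
proof -
  have eq: "r x dvd n div \<Prod>S \<longleftrightarrow> S \<subseteq> {p \<in> P. p dvd n div r x}"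
    if "x \<in> X" "S \<in> Pow P" for x S
  proof -
    have fS: "finite S" using that assms finite_subset by auto
    have S: "\<Prod>S dvd n"
      using that P prod_primes_dvd_iff[OF fS, of n] by blast
    then obtain a where a: "n = \<Prod>S * a" by auto
    have "r x dvd n" using r that by blast
    then obtain b where b: "n = r x * b" by (elim dvdE)
    have pos: "\<Prod>S > 0" "r x > 0" using a b assms by (auto intro!: Nat.gr0I)
    have "r x dvd n div \<Prod>S \<longleftrightarrow> r x * \<Prod>S dvd n"
      using a pos by (simp add: mult.commute)
    also have "\<dots> \<longleftrightarrow> \<Prod>S dvd n div r x"
      using b pos by simp
    also have "\<dots> \<longleftrightarrow> (\<forall>p\<in>S. p dvd n div r x)"
      using that P fS by (intro prod_primes_dvd_iff) auto
    finally show ?thesis using that by auto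
  qed
  have one: "(\<Sum>S\<in>Pow P. (-1) ^ card S * of_bool (r x dvd n div \<Prod>S)) = (of_bool (r x = n) :: int)"
    if x: "x \<in> X" for x
  proof -
    let ?Q = "{p \<in> P. p dvd n div r x}"
    have "(\<Sum>S\<in>Pow P. (-1) ^ card S * (of_bool (r x dvd n div \<Prod>S) :: int))
        = (\<Sum>S\<in>Pow P. if S \<in> Pow ?Q then (-1) ^ card S else 0)"
      by (intro sum.cong) (auto simp: eq[OF x])
    also have "\<dots> = (\<Sum>S\<in>Pow ?Q. (-1) ^ card S)"
      using assms by (subst sum.inter_restrict[symmetric]) (auto intro!: sum.cong)
    also have "\<dots> = of_bool (?Q = {})"
      using assms by (intro sum_alternating_Pow) auto
    also have "?Q = {} \<longleftrightarrow> r x = n"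
    proof
      assume "r x = n"
      then show "?Q = {}" using \<open>n > 0\<close> P by (auto dest!: P)
    qed (use r[OF x] in auto)
    finally show ?thesis .
  qed
  have "(\<Sum>S\<in>Pow P. (-1) ^ card S * int (card {x \<in> X. r x dvd n div \<Prod>S}))
      = (\<Sum>S\<in>Pow P. \<Sum>x\<in>X. (-1) ^ card S * of_bool (r x dvd n div \<Prod>S))"
    using assms by (intro sum.cong refl)
      (simp add: sum_distrib_left[symmetric] of_bool_def sum.If_cases Collect_conj_eq Int_commute)
  also have "\<dots> = (\<Sum>x\<in>X. of_bool (r x = n))"
    by (subst sum.swap) (simp add: one)
  also have "\<dots> = int (card {x \<in> X. r x = n})"
    using assms by (simp add: of_bool_def sum.If_cases Collect_conj_eq Int_commute)
  finally show ?thesis .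
qed

text \<open>Only squarefree divisors contribute, and these correspond to sets of prime factors by
  taking products.\<close>

lemma Phi1_eq_subset_sum:
  assumes "n > 0"
  shows "Phi1 f n = (\<Sum>S\<in>Pow (prime_factors n). (-1) ^ card S * f (n div \<Prod>S))"
proof -
  have pf: "prime_factors (\<Prod>S) = S" and sf: "squarefree (\<Prod>S)" and dv: "\<Prod>S dvd n"
    if "S \<subseteq> prime_factors n" for S
  proof -
    have fS: "finite S" using that finite_subset by auto
    have pr: "prime p" "p dvd n" if "p \<in> S" for p
      using \<open>S \<subseteq> _\<close> that by auto
    show "\<Prod>S dvd n" using prod_primes_dvd_iff[OF fS] pr by blast
    show "squarefree (\<Prod>S)"
      using pr by (intro squarefree_prod_coprime) (auto simp: primes_coprime squarefree_prime)
    have "\<Prod>S \<noteq> 0" using pr fS by (auto simp: prod_zero_iff dest: prime_gt_0_nat)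
    then have "p \<in> prime_factors (\<Prod>S) \<longleftrightarrow> p \<in> S" for p
      using fS pr by (auto simp: prime_factors_dvd prime_dvd_prod_iff) (use primes_dvd_imp_eq in blast)
    then show "prime_factors (\<Prod>S) = S" by blast
  qed
  have prod_pf: "\<Prod>(prime_factors d) = d" if "squarefree d" for d :: nat
  proof -
    have "d \<noteq> 0" using that by (intro notI) simp
    have "d = (\<Prod>p\<in>prime_factors d. p ^ multiplicity p d)"
      using \<open>d \<noteq> 0\<close> by (simp add: prime_factorization_nat)
    also have "\<dots> = (\<Prod>p\<in>prime_factors d. p)"
      using that \<open>d \<noteq> 0\<close>
      by (intro prod.cong) (auto simp: squarefree_factorial_semiring')
    finally show ?thesis by simp
  qed
  have mono: "p \<in> prime_factors n" if "p \<in> prime_factors d" "d dvd n" for p d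
    using dvd_prime_factors[of n d] that assms by auto
  have "Phi1 f n = (\<Sum>d | d dvd n \<and> squarefree d. moebius d * f (n div d))"
    unfolding Phi1_def using assms
    by (intro sum.mono_neutral_right) (auto simp: moebius_def)
  also have "\<dots> = (\<Sum>S\<in>Pow (prime_factors n). (-1) ^ card S * f (n div \<Prod>S))"
    using assms mono
    by (intro sum.reindex_bij_witness[where i = "\<lambda>S. \<Prod>S" and j = prime_factors])
       (auto simp: prod_pf pf sf dv moebius_def)
  finally show ?thesis .
qed

section \<open>Orbits and least periods\<close>

lemma funpow_orbit_card_dvd:
  fixes f :: "'a \<Rightarrow> 'a"
  assumes "finite B" "n > 0" and closed: "\<And>x. x \<in> B \<Longrightarrow> f x \<in> B"
    and per: "\<And>x. x \<in> B \<Longrightarrow> (f ^^ n) x = x"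
    and least: "\<And>x k. x \<in> B \<Longrightarrow> 0 < k \<Longrightarrow> k < n \<Longrightarrow> (f ^^ k) x \<noteq> x"
  shows "n dvd card B"
proof -
  define O' where "O' x = (\<lambda>k. (f ^^ k) x) ` {..<n}" for x
  have it: "(f ^^ k) x \<in> B" if "x \<in> B" for x k
    using that by (induction k) (auto intro: closed)
  have cO: "card (O' x) = n" if x: "x \<in> B" for x
  proof -
    have "inj_on (\<lambda>k. (f ^^ k) x) {..<n}"
    proof (rule linorder_inj_onI')
      fix i k assume ik: "i \<in> {..<n}" "k \<in> {..<n}" "i < k"
      show "(f ^^ i) x \<noteq> (f ^^ k) x"
      proof
        assume "(f ^^ i) x = (f ^^ k) x"
        then have "(f ^^ (k - i)) ((f ^^ i) x) = (f ^^ i) x"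
          using funpow_add[of "k - i" i f] ik by simp
        moreover have "0 < k - i" "k - i < n" using ik by auto
        ultimately show False using least[OF it[OF x]] by blast
      qed
    qed
    then show ?thesis by (simp add: O'_def card_image)
  qed
  have sub: "O' y \<subseteq> O' x" if "x \<in> B" and y: "y \<in> O' x" for x y
  proof
    fix z assume "z \<in> O' y"
    then obtain i where "z = (f ^^ i) y" by (auto simp: O'_def)
    moreover obtain k where "y = (f ^^ k) x" using y by (auto simp: O'_def)
    ultimately have "z = (f ^^ i) ((f ^^ k) x)" by simp
    then have "z = (f ^^ (i + k)) x" by (simp add: funpow_add)
    then have "z = (f ^^ ((i + k) mod n)) x" by (simp add: funpow_mod_eq per \<open>x \<in> B\<close>)
    then show "z \<in> O' x" using \<open>n > 0\<close> by (auto simp: O'_def)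
  qed
  \<comment> \<open>The orbit of a point of \<open>O' x\<close> is contained in \<open>O' x\<close>
    and has the same size \<open>n\<close>; hence orbits are equal or disjoint.\<close>
  have eq: "O' y = O' x" if "x \<in> B" "y \<in> O' x" for x y
  proof (rule card_subset_eq)
    have "y \<in> B" using that it by (auto simp: O'_def)
    then show "card (O' y) = card (O' x)" using that by (simp add: cO)
  qed (use sub that in \<open>auto simp: O'_def\<close>)
  have "\<Union>(O' ` B) = B"
  proof
    show "B \<subseteq> \<Union>(O' ` B)"
    proof
      fix x assume "x \<in> B"
      moreover have "x \<in> O' x" unfolding O'_def using \<open>n > 0\<close> by (intro image_eqI[where x = 0]) auto
      ultimately show "x \<in> \<Union>(O' ` B)" by blast
    qed
  qed (auto simp: O'_def it)
  moreover have "n dvd card (\<Union>(O' ` B))"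
  proof (rule dvd_partition)
    show "\<forall>c1\<in>O' ` B. \<forall>c2\<in>O' ` B. c1 \<noteq> c2 \<longrightarrow> c1 \<inter> c2 = {}"
      using eq by blast
  qed (use \<open>finite B\<close> \<open>\<Union>(O' ` B) = B\<close> in \<open>auto simp: cO\<close>)
  ultimately show ?thesis by simp
qed

definition least_period :: "('a \<Rightarrow> 'a) \<Rightarrow> 'a \<Rightarrow> nat" where
  "least_period f x = (LEAST k. 0 < k \<and> (f ^^ k) x = x)"

lemma funpow_eq_iff_least_period_dvd:
  assumes "(f ^^ n) x = x" "n > 0"
  shows "(f ^^ k) x = x \<longleftrightarrow> least_period f x dvd k"
proof -
  let ?p = "least_period f x"
  have p: "0 < ?p \<and> (f ^^ ?p) x = x"
    unfolding least_period_def using LeastI[of "\<lambda>k. 0 < k \<and> (f ^^ k) x = x" n] assms by simp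
  then have mod: "(f ^^ (k mod ?p)) x = (f ^^ k) x" using p by (simp add: funpow_mod_eq)
  show "(f ^^ k) x = x \<longleftrightarrow> ?p dvd k"
  proof
    assume "(f ^^ k) x = x"
    then have "(f ^^ (k mod ?p)) x = x" using mod by simp
    moreover have "k mod ?p < ?p" using p by simp
    ultimately have "\<not> 0 < k mod ?p"
      using not_less_Least[of "k mod ?p" "\<lambda>k. 0 < k \<and> (f ^^ k) x = x",
          folded least_period_def] by simp
    then show "?p dvd k" by (simp add: dvd_eq_mod_eq_0)
  qed (use mod in auto)
qed

lemma least_period_image:
  assumes "(f ^^ n) x = x" "n > 0"
  shows "least_period f (f x) = least_period f x"
proof -
  have per: "(f ^^ n) (f x) = f x" using assms by (simp add: funpow_swap1[symmetric])
  have "(f ^^ k) (f x) = f x \<longleftrightarrow> (f ^^ k) x = x" for k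
  proof
    assume "(f ^^ k) (f x) = f x"
    \<comment> \<open>Another \<open>n - 1\<close> applications of \<open>f\<close> complete the
      period and so undo the first one.\<close>
    then have "(f ^^ Suc (n - 1)) ((f ^^ k) x) = (f ^^ Suc (n - 1)) x"
      unfolding funpow_Suc_right by (simp add: funpow_swap1)
    then have "(f ^^ n) ((f ^^ k) x) = x" using assms by simp
    moreover have "(f ^^ n) ((f ^^ k) x) = (f ^^ k) ((f ^^ n) x)"
      using funpow_add[of n k f] funpow_add[of k n f] by (simp add: add.commute fun_eq_iff)
    ultimately show "(f ^^ k) x = x" using assms by simp
  qed (simp add: funpow_swap1[symmetric])
  then have "least_period f (f x) dvd k \<longleftrightarrow> least_period f x dvd k" for k
    using funpow_eq_iff_least_period_dvd[OF per] funpow_eq_iff_least_period_dvd[OF assms] assms by auto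
  then show ?thesis by (meson dvd_antisym dvd_refl)
qed

lemma card_least_period_dvd:
  assumes "finite B" "n > 0" "\<And>x. x \<in> B \<Longrightarrow> f x \<in> B"
    and per: "\<And>x. x \<in> B \<Longrightarrow> (f ^^ n) x = x \<and> least_period f x = n"
  shows "n dvd card B"
proof (rule funpow_orbit_card_dvd[where f = f])
  fix x k assume "x \<in> B" "0 < k" "k < n"
  then show "(f ^^ k) x \<noteq> x"
    using funpow_eq_iff_least_period_dvd[of n f x k] per[of x] by (auto dest: dvd_imp_le)
qed (use assms in auto)

section \<open>Congruences\<close>

lemma Phi1_card_periodic_points:
  fixes f :: "'a \<Rightarrow> 'a"
  assumes "n \<ge> 1" and maps: "\<And>x. x \<in> A \<Longrightarrow> f x \<in> A"
    and fin: "\<And>k. k \<ge> 1 \<Longrightarrow> finite {x \<in> A. (f ^^ k) x = x}"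
    and a: "\<And>k. k \<ge> 1 \<Longrightarrow> a k = int (card {x \<in> A. (f ^^ k) x = x})"
  shows "[Phi1 a n = 0] (mod int n)"
proof -
  let ?X = "{x \<in> A. (f ^^ n) x = x}"
  let ?B = "{x \<in> ?X. least_period f x = n}"
  have iff: "(f ^^ k) x = x \<longleftrightarrow> least_period f x dvd k" if "x \<in> ?X" for x k
    using that \<open>n \<ge> 1\<close> by (intro funpow_eq_iff_least_period_dvd[of n]) auto
  have "Phi1 a n = (\<Sum>S\<in>Pow (prime_factors n). (-1) ^ card S * a (n div \<Prod>S))"
    using assms by (intro Phi1_eq_subset_sum) auto
  also have "\<dots> = (\<Sum>S\<in>Pow (prime_factors n).
      (-1) ^ card S * int (card {x \<in> ?X. least_period f x dvd n div \<Prod>S}))"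
  proof (intro sum.cong refl arg_cong2[where f = "(*)"])
    fix S assume S: "S \<in> Pow (prime_factors n)"
    then have "finite S" using finite_subset by blast
    then have "\<Prod>S dvd n" using S by (subst prod_primes_dvd_iff) auto
    then have d: "n div \<Prod>S dvd n" "n div \<Prod>S \<ge> 1"
      using \<open>n \<ge> 1\<close> by (auto elim!: dvdE)
    \<comment> \<open>The exponent divides \<open>n\<close>, so these points already lie in
      \<open>?X\<close>, and one set serves all terms.\<close>
    have "{x \<in> A. (f ^^ (n div \<Prod>S)) x = x} = {x \<in> ?X. least_period f x dvd n div \<Prod>S}"
    proof (intro Collect_cong iffI conjI; elim conjE)
      fix x assume x: "x \<in> A" "(f ^^ (n div \<Prod>S)) x = x"
      then have dvd: "(f ^^ k) x = x \<longleftrightarrow> least_period f x dvd k" for k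
        using d by (intro funpow_eq_iff_least_period_dvd) auto
      then show "least_period f x dvd n div \<Prod>S" using x by blast
      then show "x \<in> ?X" using x dvd d dvd_trans by blast
    next
      fix x assume x: "x \<in> ?X" "least_period f x dvd n div \<Prod>S"
      then show "(f ^^ (n div \<Prod>S)) x = x" using iff[OF x(1)] by simp
    qed simp
    then show "a (n div \<Prod>S) = int (card {x \<in> ?X. least_period f x dvd n div \<Prod>S})"
      using a[OF d(2)] by simp
  qed
  also have "\<dots> = int (card ?B)"
  proof (rule alternating_sum_card_periods)
    fix x assume x: "x \<in> ?X"
    then have dvd: "least_period f x dvd n" using iff[OF x, of n] by simp
    have "\<exists>p\<in>prime_factors n. p dvd n div least_period f x" if "least_period f x \<noteq> n"
    proof -
      have "n div least_period f x \<noteq> 1" using dvd that \<open>n \<ge> 1\<close> by (auto elim!: dvdE)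
      then obtain p where p: "prime p" "p dvd n div least_period f x" using prime_factor_nat by blast
      then have "p dvd n" using dvd by (metis dvd_mult_div_cancel dvd_mult)
      then show ?thesis using p \<open>n \<ge> 1\<close> by (auto simp: prime_factors_dvd)
    qed
    with dvd show "least_period f x dvd n \<and>
        (least_period f x = n \<or> (\<exists>p\<in>prime_factors n. p dvd n div least_period f x))" by blast
  qed (use fin \<open>n \<ge> 1\<close> in \<open>auto simp: prime_factors_dvd\<close>)
  also have "[int (card ?B) = 0] (mod int n)"
  proof -
    have "n dvd card ?B"
      using finite_subset[OF _ fin[OF \<open>n \<ge> 1\<close>], of ?B] maps \<open>n \<ge> 1\<close>
      by (intro card_least_period_dvd[where f = f])
         (auto simp: least_period_image[of n] funpow_swap1[symmetric])
    then show ?thesis by (simp add: cong_0_iff)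
  qed
  finally show ?thesis .
qed

text \<open>The point \<open>0\<close> solves every equation and is split off. For the other
  solutions half the least period plays the role of the period; its quotient into \<open>n\<close>
  is odd, which is why odd primes suffice.\<close>

lemma Phi2_card_antiperiodic_points:
  fixes f :: "real \<Rightarrow> real"
  assumes "n \<ge> 1" and maps: "\<And>x. x \<in> A \<Longrightarrow> f x \<in> A" and odd_f: "\<And>x. f (- x) = - f x"
    and "0 \<in> A"
    and fin: "\<And>k. k \<ge> 1 \<Longrightarrow> finite {x \<in> A. (f ^^ k) x = - x}"
    and a: "\<And>k. k \<ge> 1 \<Longrightarrow> a k = int (card {x \<in> A. (f ^^ k) x = - x})"
  shows "[Phi2 a n = 0] (mod (2 * int n))"
proof -
  have odd_it: "(f ^^ k) (- x) = - (f ^^ k) x" for k x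
    by (induction k) (simp_all add: odd_f)
  have zero: "(f ^^ k) 0 = 0" for k
    using odd_it[of k 0] by simp
  let ?X = "{x \<in> A - {0}. (f ^^ n) x = - x}"
  let ?r = "\<lambda>x. least_period f x div 2"
  let ?B = "{x \<in> ?X. ?r x = n}"
  let ?P = "{p. prime p \<and> odd p \<and> p dvd n}"
  have per2: "(f ^^ (2 * k)) x = x" if "(f ^^ k) x = - x" for k x
    using that odd_it[of k x] by (simp add: mult_2 funpow_add)
  \<comment> \<open>The least period divides \<open>2 k\<close> but not \<open>k\<close>, so it contains the full power of \<open>2\<close> in \<open>2 k\<close>.\<close>
  have lp: "least_period f x = 2 * ?r x \<and> ?r x dvd k \<and> odd (k div ?r x) \<and> (f ^^ ?r x) x = - x"
    if x: "(f ^^ k) x = - x" "x \<noteq> 0" "k \<ge> 1" for x k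
  proof -
    have iff: "(f ^^ m) x = x \<longleftrightarrow> least_period f x dvd m" for m
      using per2[OF x(1)] x by (intro funpow_eq_iff_least_period_dvd[of "2 * k"]) auto
    have "least_period f x dvd 2 * k" using per2[OF x(1)] iff by blast
    then obtain c where c: "2 * k = least_period f x * c" by (elim dvdE)
    have "odd c"
    proof
      assume "even c"
      then obtain b where "c = 2 * b" by (elim evenE)
      then have "least_period f x dvd k" using c by auto
      then have "x = - x" using iff x by metis
      then show False using x by simp
    qed
    then have "even (least_period f x)" using c by (metis dvd_triv_left even_mult_iff)
    then have lp2: "least_period f x = 2 * ?r x" by simp
    then have k: "k = ?r x * c" using c by (metis mult.assoc mult_left_cancel zero_neq_numeral)
    then have "?r x > 0" using x by (auto intro!: Nat.gr0I)
    obtain b where b: "c = 2 * b + 1" using \<open>odd c\<close> by (elim oddE)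
    have "k = least_period f x * b + ?r x" using k lp2 b by (simp add: algebra_simps)
    moreover have "(f ^^ (?r x mod least_period f x)) x = (f ^^ ?r x) x"
      using iff by (intro funpow_mod_eq) auto
    ultimately have "(f ^^ ?r x) x = (f ^^ k) x"
      using funpow_mod_eq[of "least_period f x" f x k] iff by simp
    then show ?thesis using lp2 k \<open>odd c\<close> \<open>?r x > 0\<close> x by simp
  qed
  have finX: "finite ?X" using finite_subset[OF _ fin[OF \<open>n \<ge> 1\<close>], of ?X] by auto
  have count: "a k = int (card {x \<in> A - {0}. (f ^^ k) x = - x}) + 1" if "k \<ge> 1" for k
  proof -
    have "{x \<in> A. (f ^^ k) x = - x} = insert 0 {x \<in> A - {0}. (f ^^ k) x = - x}"
      using \<open>0 \<in> A\<close> zero by auto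
    moreover have "finite {x \<in> A - {0}. (f ^^ k) x = - x}"
      by (rule finite_subset[OF _ fin[OF that]]) auto
    ultimately show ?thesis using a[OF that] by simp
  qed
  have finP: "finite ?P" using \<open>n \<ge> 1\<close> finite_subset[of ?P "{..n}"] by (auto dest: dvd_imp_le)
  have r: "?r x dvd n \<and> (?r x = n \<or> (\<exists>p\<in>?P. p dvd n div ?r x))" if x: "x \<in> ?X" for x
  proof -
    have l: "?r x dvd n" "odd (n div ?r x)" using lp[of n x] x \<open>n \<ge> 1\<close> by auto
    have "\<exists>p\<in>?P. p dvd n div ?r x" if "?r x \<noteq> n"
    proof -
      have "n div ?r x \<noteq> 1" using l that \<open>n \<ge> 1\<close> by (auto elim!: dvdE)
      then obtain p where p: "prime p" "p dvd n div ?r x" using prime_factor_nat by blast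
      then have "p dvd n" using l(1) by (metis dvd_mult_div_cancel dvd_mult)
      moreover have "odd p" using p l(2) dvd_trans by blast
      ultimately show ?thesis using p by blast
    qed
    with l show ?thesis by blast
  qed
  have "(\<Sum>S\<in>Pow ?P. (-1) ^ card S * (a (n div \<Prod>S) - 1))
      = (\<Sum>S\<in>Pow ?P. (-1) ^ card S * int (card {x \<in> ?X. ?r x dvd n div \<Prod>S}))"
  proof (intro sum.cong refl arg_cong2[where f = "(*)"])
    fix S assume S: "S \<in> Pow ?P"
    then have fS: "finite S" using finP finite_subset by blast
    then have "\<Prod>S dvd n" using S by (subst prod_primes_dvd_iff) auto
    then obtain m where m: "n = \<Prod>S * m" by (elim dvdE)
    have oddS: "odd (\<Prod>S)" using S fS by (auto simp: even_prod_iff)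
    have S0: "\<Prod>S > 0" and m1: "m \<ge> 1" using m \<open>n \<ge> 1\<close> by (auto intro!: Nat.gr0I simp: Suc_le_eq)
    then have nm: "n div \<Prod>S = m" using m by simp
    have "{x \<in> A - {0}. (f ^^ m) x = - x} = {x \<in> ?X. ?r x dvd m}"
    proof (intro Collect_cong iffI conjI; elim conjE)
      fix x assume x: "x \<in> A - {0}" "(f ^^ m) x = - x"
      have "(f ^^ (2 * m)) x = x" using per2 x by blast
      \<comment> \<open>As \<open>n\<close> is an odd multiple of \<open>m\<close>, it is congruent
        to \<open>m\<close> modulo the period \<open>2 * m\<close>.\<close>
      obtain b where b: "\<Prod>S = 2 * b + 1" using oddS by (elim oddE)
      have "n mod (2 * m) = m mod (2 * m)" using m b by (simp add: algebra_simps)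
      then have "(f ^^ n) x = (f ^^ m) x"
        using funpow_mod_eq[OF \<open>(f ^^ (2 * m)) x = x\<close>] by metis
      then show "x \<in> ?X" using x by simp
      show "?r x dvd m" using lp[of m x] x m1 by auto
    next
      fix x assume x: "x \<in> ?X" "?r x dvd m"
      then obtain q where q: "m = ?r x * q" by (elim dvdE)
      have l: "least_period f x = 2 * ?r x" "odd (n div ?r x)" "(f ^^ ?r x) x = - x"
        using lp[of n x] x \<open>n \<ge> 1\<close> by auto
      have "?r x > 0" using q m1 by (auto intro!: Nat.gr0I)
      \<comment> \<open>Since this quotient is odd, so is \<open>q\<close>; hence \<open>m\<close>
        is congruent to \<open>?r x\<close> modulo \<open>2 * ?r x\<close>.\<close>
      then have "n div ?r x = q * \<Prod>S" using m q by (simp add: ac_simps)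
      then have "odd q" using l by simp
      then obtain b where "q = 2 * b + 1" by (elim oddE)
      then have "m mod (2 * ?r x) = ?r x mod (2 * ?r x)" using q by (simp add: algebra_simps)
      then have "(f ^^ m) x = (f ^^ ?r x) x"
        using funpow_mod_eq[OF per2[OF l(3)]] by metis
      then show "(f ^^ m) x = - x" using l by simp
    qed auto
    then show "a (n div \<Prod>S) - 1 = int (card {x \<in> ?X. ?r x dvd n div \<Prod>S})"
      using count[OF m1] nm by simp
  qed
  also have "\<dots> = int (card ?B)"
    using \<open>n \<ge> 1\<close> by (intro alternating_sum_card_periods finX finP r) auto
  finally have main: "(\<Sum>S\<in>Pow ?P. (-1) ^ card S * (a (n div \<Prod>S) - 1)) = int (card ?B)" .
  \<comment> \<open>For a power of two the only index is the empty set, with term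
    \<open>a n - 1\<close>; otherwise the contributions of the point \<open>0\<close> cancel in the
    alternating sum.\<close>
  have "Phi2 a n = (\<Sum>S\<in>Pow ?P. (-1) ^ card S * (a (n div \<Prod>S) - 1))"
  proof (cases "\<exists>k. n = 2 ^ k")
    case True
    then have "p = 2" if "prime p" "p dvd n" for p
      using that by (metis prime_dvd_power primes_dvd_imp_eq two_is_prime_nat)
    then have "?P = {}" by auto
    show ?thesis unfolding \<open>?P = {}\<close> using True by (simp add: Phi2_def)
  next
    case False
    have "?P \<noteq> {}"
    proof
      assume P: "?P = {}"
      have "n = 2 ^ multiplicity 2 n"
      proof -
        obtain q where q: "n = 2 ^ multiplicity 2 n * q" "odd q"
          using multiplicity_decompose'[of n 2] \<open>n \<ge> 1\<close> by auto
        have "q = 1"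
        proof (rule ccontr)
          assume "q \<noteq> 1"
          then obtain p where "prime p" "p dvd q" using prime_factor_nat by blast
          with q P show False by (metis (mono_tags, lifting) dvd_mult dvd_trans empty_Collect_eq)
        qed
        then show ?thesis using q by simp
      qed
      with False show False by blast
    qed
    then have "(\<Sum>S\<in>Pow ?P. (-1) ^ card S) = (0::int)"
      using sum_alternating_Pow[OF finP] by simp
    then show ?thesis
      using False by (simp add: Phi2_def right_diff_distrib sum_subtractf)
  qed
  also note main
  also have "[int (card ?B) = 0] (mod (2 * int n))"
  proof -
    have "2 * n dvd card ?B"
    proof (rule card_least_period_dvd[where f = f])
      fix x assume x: "x \<in> ?B"
      then have px: "(f ^^ (2 * n)) x = x" "(f ^^ n) x = - x" "x \<noteq> 0" using per2 by auto
      then show "(f ^^ (2 * n)) x = x \<and> least_period f x = 2 * n"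
        using lp[of n x] x \<open>n \<ge> 1\<close> by auto
      have fn: "(f ^^ n) (f x) = - f x"
        using px by (simp add: funpow_swap1[symmetric] odd_f)
      moreover have "f x \<noteq> 0"
      proof
        assume "f x = 0"
        then have "(f ^^ Suc (n - 1)) x = 0" unfolding funpow_Suc_right by (simp add: zero)
        then show False using px \<open>n \<ge> 1\<close> by simp
      qed
      moreover have "least_period f (f x) = least_period f x"
        using px \<open>n \<ge> 1\<close> by (intro least_period_image[of "2 * n"]) auto
      ultimately show "f x \<in> ?B" using x maps by auto
    qed (use finite_subset[OF _ finX, of ?B] \<open>n \<ge> 1\<close> in auto)
    then have "int (2 * n) dvd int (card ?B)" by (simp only: of_nat_dvd_iff)
    then show ?thesis by (simp add: cong_0_iff)
  qed
  finally show ?thesis .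
qed

theorem theorem5:
  fixes j :: nat
  assumes "j \<ge> 2"
  shows
    "(\<forall>n\<ge>1. finite {x \<in> {- real j..real j}. (g_map j ^^ n) x = x} \<and>
             int (card {x \<in> {- real j..real j}. (g_map j ^^ n) x = x}) = phi j n) \<and>
     (\<forall>n\<ge>1. [Phi1 (phi j) n = 0] (mod int n)) \<and>
     (\<forall>n\<ge>1. finite {x \<in> {- real j..real j}. (g_map j ^^ n) x = - x} \<and>
             int (card {x \<in> {- real j..real j}. (g_map j ^^ n) x = - x}) = psi j n) \<and>
     (\<forall>n\<ge>1. [Phi2 (psi j) n = 0] (mod (2 * int n)))"
proof -
  have a: "finite {x \<in> {- real j..real j}. (g_map j ^^ n) x = x}"
    "phi j n = int (card {x \<in> {- real j..real j}. (g_map j ^^ n) x = x})" if "n \<ge> 1" for n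
    using card_solutions[OF assms that, of 1] that assms
    by (simp_all add: phi_eq_traces sum_walk_count_closed)
  have b: "finite {x \<in> {- real j..real j}. (g_map j ^^ n) x = - x}"
    "psi j n = int (card {x \<in> {- real j..real j}. (g_map j ^^ n) x = - x})" if "n \<ge> 1" for n
    using card_solutions[OF assms that, of "-1"] that assms
    by (simp_all add: psi_eq_traces sum_walk_count_reflected)
  have "[Phi1 (phi j) n = 0] (mod int n)" if "n \<ge> 1" for n
    using that g_map_self_map[OF assms] a by (rule Phi1_card_periodic_points)
  moreover have "[Phi2 (psi j) n = 0] (mod (2 * int n))" if "n \<ge> 1" for n
    using that g_map_self_map[OF assms] g_map_uminus _ b
    by (rule Phi2_card_antiperiodic_points) auto
  ultimately show ?thesis using a b by simp
qed

end
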